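(* Let $M$ be an oriented Riemannian manifold with $\dim M\ge 3$, let $\gamma:I \to M$ be a Frenet helix of order $3$ with Frenet field $\{T,N,B\}$, constant curvature $\kappa$ and constant torsion $\tau$, and let $r \geq 2$ be an integer. Assume that along $\gamma$ \[ \langle R(N,T)T,W \rangle =0 \quad\text{and}\quad \langle R(N,B)T,W \rangle =0\qquad \text{for all } W \in \big (\mathrm{Span}\{T,N,B\}\big)^\perp . \] Put $A_1= \kappa^2 (r-1)+\tau ^2$, $A_2= - \kappa \tau (r - 2)$, $A_3= -(\kappa^2+\tau ^2)^2$. Then $\gamma$ is proper $r$-harmonic if and only if the following two equations hold along $\gamma$: \[ \text{(i)}\quad A_1 R(N,T,N,T)+A_2 R(N,B,N,T)+A_3=0, \] \[ \text{(ii)}\quad A_1 R(N,T,B,T)+A_2 R(N,B,B,T)=0 . \]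
   Context: $M$ is an oriented Riemannian manifold with Levi-Civita connection $\nabla$, curvature $R(X,Y)Z=\nabla_X\nabla_YZ-\nabla_Y\nabla_XZ-\nabla_{[X,Y]}Z$ and $R(X,Y,Z,W)=\langle R(X,Y)W,Z\rangle$. Curves $\gamma:I\to M$ ($I\subset\mathbb{R}$ an interval) are smooth and parametrized by arc length, with unit tangent $T=\gamma'$. Put $\nabla^0_TT=T$, $\nabla_T^kT=\nabla_T(\nabla_T^{k-1}T)$. For an integer $r\ge 2$, $\gamma$ is $r$-harmonic if \[ \tau_r(\gamma)=\nabla^{2r-1}_T T+ \sum_{\ell=0}^{r-2}(-1)^\ell R\left (\nabla^{2r-3-\ell}_T T ,\nabla^{\ell}_T T\right )T=0, \] and proper $r$-harmonic if it is $r$-harmonic and not a geodesic. A Frenet helix of order $3$ is such a curve admitting an orthonormal field $\{T,N,B\}$ along $\gamma$ and constants $\kappa>0$, $\tau$ with $\nabla_TT=\kappa N$, $\nabla_TN=-\kappa T+\tau B$, $\nabla_TB=-\tau N$; if $\dim M\ge 4$ then $\tau>0$, while if $\dim M=3$ the frame $\{T,N,B\}$ is positively oriented and $\tau$ may be any real number. *)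

theory Defs
  imports "HOL-Analysis.Analysis"
begin

text \<open>
  Smoothness is taken within the domain \<open>S\<close>, so that one notion serves open subsets of Euclidean
  space as well as (relatively open subsets of) arbitrary nondegenerate intervals, with one-sided
  derivatives at end points.  In both cases the derivative within \<open>S\<close> is unique.
\<close>

primrec Ck_on :: "nat \<Rightarrow> 'a::real_normed_vector set \<Rightarrow> ('a \<Rightarrow> 'b::real_normed_vector) \<Rightarrow> bool" where
  "Ck_on 0 S f = continuous_on S f"
| "Ck_on (Suc k) S f = (f differentiable_on S \<and>
     (\<forall>v. Ck_on k S (\<lambda>x. frechet_derivative f (at x within S) v)))"

definition smooth_on :: "'a::real_normed_vector set \<Rightarrow> ('a \<Rightarrow> 'b::real_normed_vector) \<Rightarrow> bool" where
  "smooth_on S f \<longleftrightarrow> (\<forall>k. Ck_on k S f)"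


section \<open>Oriented Riemannian manifolds\<close>

text \<open>
  A chart is a pair of its domain and its coordinate map (whose values off the domain are
  irrelevant).  The manifold has dimension \<open>CARD('n)\<close>; the linear order on \<open>'n\<close> is the order of the
  coordinates and is used only to fix the standard orientation of \<open>real ^ 'n\<close>.
\<close>

type_synonym ('m, 'n) chart = "'m set \<times> ('m \<Rightarrow> real ^ 'n)"

text \<open>
  A tangent vector at \<open>p\<close> is the family of its coordinate vectors in all charts around \<open>p\<close>, related
  by the Jacobians of the coordinate changes (and set to 0 on all other arguments, so that tangent
  vectors are equal iff their coordinates are).  Linear operations are componentwise.
\<close>

type_synonym ('m, 'n) tvec = "('m, 'n) chart \<Rightarrow> real ^ 'n"

record ('m, 'n) riem =
  mtop :: "'m topology"
  atlas :: "('m, 'n) chart set"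
  metric :: "'m \<Rightarrow> ('m, 'n) tvec \<Rightarrow> ('m, 'n) tvec \<Rightarrow> real"

definition chart_inv :: "('m, 'n::finite) chart \<Rightarrow> real ^ 'n \<Rightarrow> 'm" where
  "chart_inv c = inv_into (fst c) (snd c)"

definition transition :: "('m, 'n::finite) chart \<Rightarrow> ('m, 'n) chart \<Rightarrow> real ^ 'n \<Rightarrow> real ^ 'n" where
  "transition c d = snd d \<circ> chart_inv c"

definition charts_at :: "('m, 'n::finite) riem \<Rightarrow> 'm \<Rightarrow> ('m, 'n) chart set" where
  "charts_at M p = {c \<in> atlas M. p \<in> fst c}"

definition is_chart :: "'m topology \<Rightarrow> ('m, 'n::finite) chart \<Rightarrow> bool" where
  "is_chart X c \<longleftrightarrow> openin X (fst c) \<and> open (snd c ` fst c) \<and>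
     homeomorphic_map (subtopology X (fst c)) (top_of_set (snd c ` fst c)) (snd c)"

definition smooth_manifold :: "('m, 'n::finite) riem \<Rightarrow> bool" where
  "smooth_manifold M \<longleftrightarrow>
     Hausdorff_space (mtop M) \<and> second_countable (mtop M) \<and>
     (\<forall>c\<in>atlas M. is_chart (mtop M) c) \<and> (\<Union>c\<in>atlas M. fst c) = topspace (mtop M) \<and>
     (\<forall>c\<in>atlas M. \<forall>d\<in>atlas M. smooth_on (snd c ` (fst c \<inter> fst d)) (transition c d))"

text \<open>The orientation is the one given by the atlas itself.\<close>

definition oriented_atlas :: "('m, 'n::finite) riem \<Rightarrow> bool" where
  "oriented_atlas M \<longleftrightarrow> (\<forall>c\<in>atlas M. \<forall>d\<in>atlas M. \<forall>x\<in>snd c ` (fst c \<inter> fst d).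
     det (matrix (frechet_derivative (transition c d) (at x))) > 0)"

definition tangent_space :: "('m, 'n::finite) riem \<Rightarrow> 'm \<Rightarrow> ('m, 'n) tvec set" where
  "tangent_space M p = {v.
     (\<forall>c\<in>charts_at M p. \<forall>d\<in>charts_at M p.
        v d = frechet_derivative (transition c d) (at (snd c p)) (v c)) \<and>
     (\<forall>c. c \<notin> charts_at M p \<longrightarrow> v c = 0)}"

text \<open>The tangent vector at \<open>p\<close> with coordinates \<open>u\<close> in the chart \<open>c\<close>.\<close>

definition coord_vec :: "('m, 'n::finite) riem \<Rightarrow> 'm \<Rightarrow> ('m, 'n) chart \<Rightarrow> real ^ 'n \<Rightarrow> ('m, 'n) tvec" where
  "coord_vec M p c u = (\<lambda>d. if d \<in> charts_at M p
     then frechet_derivative (transition c d) (at (snd c p)) u else 0)"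

definition local_metric ::
    "('m, 'n::finite) riem \<Rightarrow> ('m, 'n) chart \<Rightarrow> real ^ 'n \<Rightarrow> real ^ 'n \<Rightarrow> real ^ 'n \<Rightarrow> real" where
  "local_metric M c x u v = (let p = chart_inv c x in
     metric M p (coord_vec M p c u) (coord_vec M p c v))"

definition riemannian_metric :: "('m, 'n::finite) riem \<Rightarrow> bool" where
  "riemannian_metric M \<longleftrightarrow>
     (\<forall>p\<in>topspace (mtop M). \<forall>u\<in>tangent_space M p.
        (\<forall>v\<in>tangent_space M p. metric M p u v = metric M p v u \<and>
           (\<forall>w\<in>tangent_space M p. \<forall>a.
              metric M p (\<lambda>c. a *\<^sub>R u c + v c) w = a * metric M p u w + metric M p v w)) \<and>
        (u \<noteq> (\<lambda>_. 0) \<longrightarrow> metric M p u u > 0)) \<and>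
     (\<forall>c\<in>atlas M. \<forall>u v. smooth_on (snd c ` fst c) (\<lambda>x. local_metric M c x u v))"

definition oriented_riemannian_manifold :: "('m, 'n::finite) riem \<Rightarrow> bool" where
  "oriented_riemannian_manifold M \<longleftrightarrow>
     smooth_manifold M \<and> oriented_atlas M \<and> riemannian_metric M"

text \<open>
  An ordered basis of the tangent space (a list of \<open>CARD('n)\<close> vectors) is positive if its coordinate
  vectors, as the columns of a matrix in the order of \<open>'n\<close>, have positive determinant;
  \<open>card {k. k < j}\<close> is the position of \<open>j\<close> in \<open>'n\<close>, counted from 0.
\<close>

definition positively_oriented ::
    "('m, 'n::{finite,linorder}) riem \<Rightarrow> 'm \<Rightarrow> ('m, 'n) tvec list \<Rightarrow> bool" where
  "positively_oriented M p vs \<longleftrightarrow> length vs = CARD('n) \<and>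
     (\<forall>c\<in>charts_at M p. det (\<chi> i j. (vs ! card {k. k < j}) c $ i) > 0)"


section \<open>Levi-Civita connection and curvature\<close>

text \<open>
  In a chart a connection is \<open>\<nabla>\<^sub>X Y = DY(X) + \<Gamma>(X, Y)\<close>.  For coordinate (constant) fields the
  conditions below say that it is torsion-free and compatible with the metric; together they
  determine \<open>\<Gamma>\<close> at each point.
\<close>

definition levi_civita_at ::
    "('m, 'n::finite) riem \<Rightarrow> ('m, 'n) chart \<Rightarrow> real ^ 'n \<Rightarrow> (real ^ 'n \<Rightarrow> real ^ 'n \<Rightarrow> real ^ 'n) \<Rightarrow> bool" where
  "levi_civita_at M c x G \<longleftrightarrow> bilinear G \<and> (\<forall>u v. G u v = G v u) \<and>
     (\<forall>u v w. frechet_derivative (\<lambda>y. local_metric M c y v w) (at x) u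
        = local_metric M c x (G u v) w + local_metric M c x v (G u w))"

definition christoffel ::
    "('m, 'n::finite) riem \<Rightarrow> ('m, 'n) chart \<Rightarrow> real ^ 'n \<Rightarrow> real ^ 'n \<Rightarrow> real ^ 'n \<Rightarrow> real ^ 'n" where
  "christoffel M c x = (THE G. levi_civita_at M c x G)"

text \<open>Vector fields on the domain of \<open>c\<close>, written in the coordinates of \<open>c\<close>.\<close>

type_synonym 'n local_field = "real ^ 'n \<Rightarrow> real ^ 'n"

definition local_nabla ::
    "('m, 'n::finite) riem \<Rightarrow> ('m, 'n) chart \<Rightarrow> 'n local_field \<Rightarrow> 'n local_field \<Rightarrow> 'n local_field" where
  "local_nabla M c X Y = (\<lambda>x. frechet_derivative Y (at x) (X x) + christoffel M c x (X x) (Y x))"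

definition lie_bracket :: "'n::finite local_field \<Rightarrow> 'n local_field \<Rightarrow> 'n local_field" where
  "lie_bracket X Y = (\<lambda>x. frechet_derivative Y (at x) (X x) - frechet_derivative X (at x) (Y x))"

definition local_curvature ::
    "('m, 'n::finite) riem \<Rightarrow> ('m, 'n) chart \<Rightarrow> 'n local_field \<Rightarrow> 'n local_field \<Rightarrow> 'n local_field
       \<Rightarrow> 'n local_field" where
  "local_curvature M c X Y Z = (\<lambda>x.
     local_nabla M c X (local_nabla M c Y Z) x - local_nabla M c Y (local_nabla M c X Z) x
     - local_nabla M c (lie_bracket X Y) Z x)"

text \<open>
  The tangent vectors \<open>\<nabla>\<^sub>T V\<close> and \<open>R(X, Y)Z\<close> below are computed in some chart around the point; by
  the transformation law of the Levi-Civita connection the result does not depend on the chart.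
  The curvature is tensorial, so the vectors may be extended by fields that are constant in the
  chart.
\<close>

definition chart_at :: "('m, 'n::finite) riem \<Rightarrow> 'm \<Rightarrow> ('m, 'n) chart" where
  "chart_at M p = (SOME c. c \<in> charts_at M p)"

definition curvature ::
    "('m, 'n::finite) riem \<Rightarrow> 'm \<Rightarrow> ('m, 'n) tvec \<Rightarrow> ('m, 'n) tvec \<Rightarrow> ('m, 'n) tvec \<Rightarrow> ('m, 'n) tvec" where
  "curvature M p X Y Z = (let c = chart_at M p in
     coord_vec M p c (local_curvature M c (\<lambda>_. X c) (\<lambda>_. Y c) (\<lambda>_. Z c) (snd c p)))"

text \<open>Sign convention: \<open>R(X, Y, Z, W) = \<langle>R(X, Y)W, Z\<rangle>\<close>.\<close>

definition curvature4 ::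
    "('m, 'n::finite) riem \<Rightarrow> 'm \<Rightarrow> ('m, 'n) tvec \<Rightarrow> ('m, 'n) tvec \<Rightarrow> ('m, 'n) tvec \<Rightarrow> ('m, 'n) tvec
       \<Rightarrow> real" where
  "curvature4 M p X Y Z W = metric M p (curvature M p X Y W) Z"


section \<open>Curves\<close>

definition smooth_curve :: "('m, 'n::finite) riem \<Rightarrow> real set \<Rightarrow> (real \<Rightarrow> 'm) \<Rightarrow> bool" where
  "smooth_curve M I \<gamma> \<longleftrightarrow> is_interval I \<and> interior I \<noteq> {} \<and>
     continuous_map (top_of_set I) (mtop M) \<gamma> \<and>
     (\<forall>c\<in>atlas M. smooth_on {t \<in> I. \<gamma> t \<in> fst c} (snd c \<circ> \<gamma>))"

definition velocity ::
    "('m, 'n::finite) riem \<Rightarrow> real set \<Rightarrow> (real \<Rightarrow> 'm) \<Rightarrow> real \<Rightarrow> ('m, 'n) tvec" where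
  "velocity M I \<gamma> t = (\<lambda>c. if c \<in> charts_at M (\<gamma> t)
     then vector_derivative (snd c \<circ> \<gamma>) (at t within I) else 0)"

definition unit_speed :: "('m, 'n::finite) riem \<Rightarrow> real set \<Rightarrow> (real \<Rightarrow> 'm) \<Rightarrow> bool" where
  "unit_speed M I \<gamma> \<longleftrightarrow>
     (\<forall>t\<in>I. metric M (\<gamma> t) (velocity M I \<gamma> t) (velocity M I \<gamma> t) = 1)"

definition field_along ::
    "('m, 'n::finite) riem \<Rightarrow> real set \<Rightarrow> (real \<Rightarrow> 'm) \<Rightarrow> (real \<Rightarrow> ('m, 'n) tvec) \<Rightarrow> bool" where
  "field_along M I \<gamma> V \<longleftrightarrow> (\<forall>t\<in>I. V t \<in> tangent_space M (\<gamma> t)) \<and>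
     (\<forall>c\<in>atlas M. smooth_on {t \<in> I. \<gamma> t \<in> fst c} (\<lambda>t. V t c))"

text \<open>The covariant derivative along \<open>\<gamma>\<close> in the direction of its velocity.\<close>

definition nabla_T ::
    "('m, 'n::finite) riem \<Rightarrow> real set \<Rightarrow> (real \<Rightarrow> 'm) \<Rightarrow> (real \<Rightarrow> ('m, 'n) tvec) \<Rightarrow> real \<Rightarrow> ('m, 'n) tvec" where
  "nabla_T M I \<gamma> V t = (let c = chart_at M (\<gamma> t) in
     coord_vec M (\<gamma> t) c (vector_derivative (\<lambda>s. V s c) (at t within I)
       + christoffel M c (snd c (\<gamma> t)) (velocity M I \<gamma> t c) (V t c)))"

definition nabla_pow ::
    "('m, 'n::finite) riem \<Rightarrow> real set \<Rightarrow> (real \<Rightarrow> 'm) \<Rightarrow> nat \<Rightarrow> real \<Rightarrow> ('m, 'n) tvec" where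
  "nabla_pow M I \<gamma> k = (nabla_T M I \<gamma> ^^ k) (velocity M I \<gamma>)"

definition tension ::
    "('m, 'n::finite) riem \<Rightarrow> real set \<Rightarrow> (real \<Rightarrow> 'm) \<Rightarrow> nat \<Rightarrow> real \<Rightarrow> ('m, 'n) tvec" where
  "tension M I \<gamma> r t = (\<lambda>c. nabla_pow M I \<gamma> (2 * r - 1) t c +
     (\<Sum>l = 0..r - 2. (- 1) ^ l *\<^sub>R
        curvature M (\<gamma> t) (nabla_pow M I \<gamma> (2 * r - 3 - l) t) (nabla_pow M I \<gamma> l t)
          (velocity M I \<gamma> t) c))"

definition r_harmonic :: "('m, 'n::finite) riem \<Rightarrow> real set \<Rightarrow> (real \<Rightarrow> 'm) \<Rightarrow> nat \<Rightarrow> bool" where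
  "r_harmonic M I \<gamma> r \<longleftrightarrow> smooth_curve M I \<gamma> \<and> unit_speed M I \<gamma> \<and>
     (\<forall>t\<in>I. tension M I \<gamma> r t = (\<lambda>_. 0))"

definition geodesic :: "('m, 'n::finite) riem \<Rightarrow> real set \<Rightarrow> (real \<Rightarrow> 'm) \<Rightarrow> bool" where
  "geodesic M I \<gamma> \<longleftrightarrow> smooth_curve M I \<gamma> \<and>
     (\<forall>t\<in>I. nabla_T M I \<gamma> (velocity M I \<gamma>) t = (\<lambda>_. 0))"

definition proper_r_harmonic :: "('m, 'n::finite) riem \<Rightarrow> real set \<Rightarrow> (real \<Rightarrow> 'm) \<Rightarrow> nat \<Rightarrow> bool" where
  "proper_r_harmonic M I \<gamma> r \<longleftrightarrow> r_harmonic M I \<gamma> r \<and> \<not> geodesic M I \<gamma>"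

definition orthonormal3 ::
    "('m, 'n::finite) riem \<Rightarrow> 'm \<Rightarrow> ('m, 'n) tvec \<Rightarrow> ('m, 'n) tvec \<Rightarrow> ('m, 'n) tvec \<Rightarrow> bool" where
  "orthonormal3 M p X Y Z \<longleftrightarrow>
     metric M p X X = 1 \<and> metric M p Y Y = 1 \<and> metric M p Z Z = 1 \<and>
     metric M p X Y = 0 \<and> metric M p X Z = 0 \<and> metric M p Y Z = 0"

definition frenet_helix3 ::
    "('m, 'n::{finite,linorder}) riem \<Rightarrow> real set \<Rightarrow> (real \<Rightarrow> 'm) \<Rightarrow> (real \<Rightarrow> ('m, 'n) tvec) \<Rightarrow>
     (real \<Rightarrow> ('m, 'n) tvec) \<Rightarrow> (real \<Rightarrow> ('m, 'n) tvec) \<Rightarrow> real \<Rightarrow> real \<Rightarrow> bool" where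
  "frenet_helix3 M I \<gamma> T N B \<kappa> \<tau> \<longleftrightarrow>
     smooth_curve M I \<gamma> \<and> unit_speed M I \<gamma> \<and> (\<forall>t\<in>I. T t = velocity M I \<gamma> t) \<and>
     field_along M I \<gamma> T \<and> field_along M I \<gamma> N \<and> field_along M I \<gamma> B \<and>
     (\<forall>t\<in>I. orthonormal3 M (\<gamma> t) (T t) (N t) (B t)) \<and>
     \<kappa> > 0 \<and>
     (\<forall>t\<in>I. nabla_T M I \<gamma> T t = (\<lambda>c. \<kappa> *\<^sub>R N t c) \<and>
             nabla_T M I \<gamma> N t = (\<lambda>c. - \<kappa> *\<^sub>R T t c + \<tau> *\<^sub>R B t c) \<and>
             nabla_T M I \<gamma> B t = (\<lambda>c. - \<tau> *\<^sub>R N t c)) \<and>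
     (CARD('n) \<ge> 4 \<longrightarrow> \<tau> > 0) \<and>
     (CARD('n) = 3 \<longrightarrow> (\<forall>t\<in>I. positively_oriented M (\<gamma> t) [T t, N t, B t]))"

definition span3_perp ::
    "('m, 'n::finite) riem \<Rightarrow> 'm \<Rightarrow> ('m, 'n) tvec \<Rightarrow> ('m, 'n) tvec \<Rightarrow> ('m, 'n) tvec \<Rightarrow> ('m, 'n) tvec set" where
  "span3_perp M p X Y Z = {W \<in> tangent_space M p.
     \<forall>x y z. metric M p (\<lambda>c. x *\<^sub>R X c + y *\<^sub>R Y c + z *\<^sub>R Z c) W = 0}"

end

theory Submission
  imports Defs
begin

text \<open>
  Along a helix \<open>\<nabla>\<^sub>T\<close> acts on the Frenet frame by a constant matrix, and with \<open>q = \<kappa>\<^sup>2 + \<tau>\<^sup>2\<close> it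
  satisfies \<open>\<nabla>\<^sub>T\<^sup>3 T = - q \<nabla>\<^sub>T T\<close>.  Hence the odd derivatives of \<open>T\<close> are multiples of \<open>N\<close>, the even
  ones are multiples of \<open>- \<kappa> T + \<tau> B\<close>, and the antisymmetry of \<open>R\<close> makes all curvature terms
  with \<open>\<ell> \<ge> 1\<close> equal.  Summing up, \<open>q \<tau>\<^sub>r(\<gamma>)\<close> is a nonzero multiple of
  \<open>V = A\<^sub>3 N + A\<^sub>1 R(N, T)T + A\<^sub>2 R(N, B)T\<close>.  The two equations say that \<open>V\<close> is orthogonal to \<open>N\<close> and \<open>B\<close>;
  it is orthogonal to \<open>T\<close> because \<open>\<langle>R(X, Y)Z, Z\<rangle> = 0\<close>.

  The bilinearity and skew-symmetry of \<open>R\<close> rest on the existence and differentiability of the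
  Christoffel symbols (Koszul formula and Cramer's rule) and on the symmetry of second derivatives.
\<close>

section \<open>Calculus\<close>

text \<open>The second difference is \<open>\<psi> h - \<psi> 0\<close>. The mean value theorem,
  applied first to \<open>\<psi>\<close> and then along \<open>v\<close> to the directional
  derivative in \<open>u\<close>, finds the intermediate point. The left side is symmetric in
  \<open>u\<close> and \<open>v\<close>, which is the source of the symmetry of second
  derivatives.\<close>

lemma second_difference_mean_value:
  fixes f :: "'a::real_normed_vector \<Rightarrow> real"
  assumes h: "h > 0"
    and inS: "\<And>s t. 0 \<le> s \<Longrightarrow> s \<le> h \<Longrightarrow> 0 \<le> t \<Longrightarrow> t \<le> h \<Longrightarrow> x + s *\<^sub>R u + t *\<^sub>R v \<in> S"
    and f': "\<And>y. y \<in> S \<Longrightarrow> (f has_derivative f' y) (at y)"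
    and f'': "\<And>y. y \<in> S \<Longrightarrow> ((\<lambda>z. f' z u) has_derivative f'' y) (at y)"
  obtains s t where "0 < s" "s < h" "0 < t" "t < h"
    "f (x + h *\<^sub>R u + h *\<^sub>R v) - f (x + h *\<^sub>R u) - f (x + h *\<^sub>R v) + f x
      = h\<^sup>2 * f'' (x + s *\<^sub>R u + t *\<^sub>R v) v"
proof -
  define \<psi> where "\<psi> s = f (x + s *\<^sub>R u + h *\<^sub>R v) - f (x + s *\<^sub>R u)" for s
  have lin1: "linear (f' y)" if "y \<in> S" for y
    using f'[OF that] has_derivative_linear by blast
  have lin2: "linear (f'' y)" if "y \<in> S" for y
    using f''[OF that] has_derivative_linear by blast
  have in0: "x + s *\<^sub>R u \<in> S" if "0 \<le> s" "s \<le> h" for s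
    using inS[of s 0] that h by simp
  have d1: "(\<psi> has_real_derivative (f' (x + s *\<^sub>R u + h *\<^sub>R v) u - f' (x + s *\<^sub>R u) u)) (at s)"
    if s: "0 \<le> s" "s \<le> h" for s
  proof -
    have a: "((\<lambda>s. f (x + s *\<^sub>R u + h *\<^sub>R v)) has_derivative (\<lambda>d. f' (x + s *\<^sub>R u + h *\<^sub>R v) (d *\<^sub>R u))) (at s)"
      by (rule has_derivative_compose[where g = f])
         (auto intro!: derivative_eq_intros f' inS s simp: h less_imp_le)
    have b: "((\<lambda>s. f (x + s *\<^sub>R u)) has_derivative (\<lambda>d. f' (x + s *\<^sub>R u) (d *\<^sub>R u))) (at s)"
      by (rule has_derivative_compose[where g = f])
         (auto intro!: derivative_eq_intros f' in0 s simp: h less_imp_le)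
    show ?thesis
      unfolding has_field_derivative_def \<psi>_def
      by (rule has_derivative_eq_rhs[OF has_derivative_diff[OF a b]])
         (use linear_cmul[OF lin1] inS[of s h] in0[OF s] s h in \<open>auto simp: fun_eq_iff algebra_simps\<close>)
  qed
  obtain s where s: "0 < s" "s < h"
    and s_eq: "\<psi> h - \<psi> 0 = (h - 0) * (f' (x + s *\<^sub>R u + h *\<^sub>R v) u - f' (x + s *\<^sub>R u) u)"
    using MVT2[of 0 h \<psi>, OF h d1] by blast
  have d2: "((\<lambda>t. f' (x + s *\<^sub>R u + t *\<^sub>R v) u) has_real_derivative f'' (x + s *\<^sub>R u + t *\<^sub>R v) v) (at t)"
    if t: "0 \<le> t" "t \<le> h" for t
  proof -
    have "((\<lambda>t. f' (x + s *\<^sub>R u + t *\<^sub>R v) u) has_derivative (\<lambda>d. f'' (x + s *\<^sub>R u + t *\<^sub>R v) (d *\<^sub>R v))) (at t)"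
      by (rule has_derivative_compose[where g = "\<lambda>z. f' z u"])
         (use s t in \<open>auto intro!: derivative_eq_intros f'' inS simp: less_imp_le\<close>)
    then show ?thesis
      unfolding has_field_derivative_def
      by (rule has_derivative_eq_rhs)
         (use linear_cmul[OF lin2] inS[of s t] s t in \<open>auto simp: fun_eq_iff algebra_simps\<close>)
  qed
  obtain t where t: "0 < t" "t < h"
    and t_eq: "f' (x + s *\<^sub>R u + h *\<^sub>R v) u - f' (x + s *\<^sub>R u + 0 *\<^sub>R v) u
      = (h - 0) * f'' (x + s *\<^sub>R u + t *\<^sub>R v) v"
    using MVT2[of 0 h "\<lambda>t. f' (x + s *\<^sub>R u + t *\<^sub>R v) u", OF h d2] by blast
  show ?thesis
    using that[OF s t] s_eq t_eq by (simp add: \<psi>_def power2_eq_square algebra_simps)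
qed

text \<open>Computing one small second difference in both orders shows that the two mixed
  derivatives agree at two points near \<open>x\<close>. If they differed at \<open>x\<close> by
  \<open>2 * e\<close>, continuity would keep them apart at these points as well.\<close>

lemma mixed_second_derivatives_eq:
  fixes f :: "'a::real_normed_vector \<Rightarrow> real"
  assumes S: "open S" "x \<in> S"
    and f': "\<And>y. y \<in> S \<Longrightarrow> (f has_derivative f' y) (at y)"
    and f'': "\<And>y v. y \<in> S \<Longrightarrow> ((\<lambda>z. f' z v) has_derivative f'' v y) (at y)"
    and cont: "\<And>u v. continuous_on S (\<lambda>y. f'' u y v)"
  shows "f'' u x v = f'' v x u"
proof (rule ccontr)
  assume "f'' u x v \<noteq> f'' v x u"
  define e where "e = \<bar>f'' u x v - f'' v x u\<bar> / 2"
  have e: "e > 0" using \<open>f'' u x v \<noteq> f'' v x u\<close> by (simp add: e_def)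
  have "isCont (\<lambda>y. f'' u y v) x" "isCont (\<lambda>y. f'' v y u) x"
    using cont S by (auto simp: continuous_on_eq_continuous_at)
  then obtain d1 d2 where d: "d1 > 0" "d2 > 0"
    and d1: "\<And>y. dist y x < d1 \<Longrightarrow> dist (f'' u y v) (f'' u x v) < e"
    and d2: "\<And>y. dist y x < d2 \<Longrightarrow> dist (f'' v y u) (f'' v x u) < e"
    using e unfolding continuous_at_eps_delta by metis
  obtain d3 where d3: "d3 > 0" "ball x d3 \<subseteq> S" using S open_contains_ball by blast
  define d where "d = min d1 (min d2 d3)"
  have "d > 0" using d d3 by (simp add: d_def)
  \<comment> \<open>The summand 1 keeps \<open>K\<close> positive even for \<open>u = v = 0\<close>,
    and halving in \<open>h\<close> keeps the whole parallelogram strictly within distance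
    \<open>d\<close> of \<open>x\<close>.\<close>
  define K where "K = norm u + norm v + 1"
  define h where "h = d / K / 2"
  have pos: "K > 0" unfolding K_def by (smt (verit) norm_ge_zero)
  have h: "h > 0" using \<open>d > 0\<close> pos by (simp add: h_def)
  have near: "dist (x + s *\<^sub>R u + t *\<^sub>R v) x < d" if "0 \<le> s" "s \<le> h" "0 \<le> t" "t \<le> h" for s t
  proof -
    have "dist (x + s *\<^sub>R u + t *\<^sub>R v) x \<le> norm (s *\<^sub>R u) + norm (t *\<^sub>R v)"
      by (simp add: dist_norm norm_triangle_ineq add.assoc del: norm_scaleR)
    also have "\<dots> \<le> h * norm u + h * norm v"
      using that by (auto intro!: add_mono mult_right_mono)
    also have "\<dots> \<le> h * K" using h by (simp add: K_def algebra_simps)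
    also have "\<dots> = d / 2" using pos by (simp add: h_def)
    finally show ?thesis using \<open>d > 0\<close> by simp
  qed
  have inS: "x + s *\<^sub>R u + t *\<^sub>R v \<in> S" if "0 \<le> s" "s \<le> h" "0 \<le> t" "t \<le> h" for s t
    using near[OF that] d3 by (auto simp: d_def dist_commute)
  obtain s t where st: "0 < s" "s < h" "0 < t" "t < h"
    and eq1: "f (x + h *\<^sub>R u + h *\<^sub>R v) - f (x + h *\<^sub>R u) - f (x + h *\<^sub>R v) + f x
      = h\<^sup>2 * f'' u (x + s *\<^sub>R u + t *\<^sub>R v) v"
    by (rule second_difference_mean_value[where S = S and f = f, OF h inS f' f''[of _ u]])
  have inS': "x + s *\<^sub>R v + t *\<^sub>R u \<in> S" if "0 \<le> s" "s \<le> h" "0 \<le> t" "t \<le> h" for s t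
    using inS[of t s] that by (simp add: add_ac)
  obtain s' t' where st': "0 < s'" "s' < h" "0 < t'" "t' < h"
    and eq2: "f (x + h *\<^sub>R v + h *\<^sub>R u) - f (x + h *\<^sub>R v) - f (x + h *\<^sub>R u) + f x
      = h\<^sup>2 * f'' v (x + s' *\<^sub>R v + t' *\<^sub>R u) u"
    by (rule second_difference_mean_value[where S = S and f = f, OF h inS' f' f''[of _ v]])
  have swap: "x + h *\<^sub>R v + h *\<^sub>R u = x + h *\<^sub>R u + h *\<^sub>R v" "x + s' *\<^sub>R v + t' *\<^sub>R u = x + t' *\<^sub>R u + s' *\<^sub>R v"
    by simp_all
  then have "h\<^sup>2 * f'' u (x + s *\<^sub>R u + t *\<^sub>R v) v = h\<^sup>2 * f'' v (x + t' *\<^sub>R u + s' *\<^sub>R v) u"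
    using eq1 eq2 unfolding swap by linarith
  then have "f'' u (x + s *\<^sub>R u + t *\<^sub>R v) v = f'' v (x + t' *\<^sub>R u + s' *\<^sub>R v) u"
    using h by simp
  moreover have "dist (f'' u (x + s *\<^sub>R u + t *\<^sub>R v) v) (f'' u x v) < e"
    by (rule d1) (use near[of s t] st in \<open>auto simp: d_def\<close>)
  moreover have "dist (f'' v (x + t' *\<^sub>R u + s' *\<^sub>R v) u) (f'' v x u) < e"
    by (rule d2) (use near[of t' s'] st' in \<open>auto simp: d_def\<close>)
  ultimately show False unfolding e_def dist_real_def by (smt (verit) field_sum_of_halves)
qed

section \<open>Differentiability of determinants and of solutions of linear systems\<close>

lemma differentiable_prod:
  fixes f :: "'i \<Rightarrow> 'a::real_normed_vector \<Rightarrow> 'b::real_normed_field"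
  assumes "\<And>i. i \<in> A \<Longrightarrow> f i differentiable (at x within S)"
  shows "(\<lambda>y. \<Prod>i\<in>A. f i y) differentiable (at x within S)"
proof -
  have "(f i has_derivative frechet_derivative (f i) (at x within S)) (at x within S)" if "i \<in> A" for i
    using assms[OF that] by (simp add: frechet_derivative_works)
  from has_derivative_prod[OF this] show ?thesis by (rule differentiableI)
qed

lemma differentiable_det:
  fixes A :: "'a::real_normed_vector \<Rightarrow> real ^ 'n ^ 'n::finite"
  assumes "\<And>i j. (\<lambda>y. A y $ i $ j) differentiable (at x within S)"
  shows "(\<lambda>y. det (A y)) differentiable (at x within S)"
  unfolding det_def
  by (auto intro!: differentiable_sum differentiable_mult differentiable_prod assms
      simp: finite_permutations)

lemma differentiable_vec_componentwise:
  fixes f :: "'a::real_normed_vector \<Rightarrow> real ^ 'n::finite"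
  assumes "\<And>i. (\<lambda>y. f y $ i) differentiable (at x within S)"
  shows "f differentiable (at x within S)"
  unfolding differentiable_componentwise_within[of f]
  using assms by (auto simp: Basis_vec_def inner_axis)

text \<open>By Cramer's rule each coordinate of \<open>z\<close> is, on all of \<open>S\<close>, a
  quotient of determinants with entries differentiable at \<open>x\<close>.\<close>

lemma differentiable_solution_linear_system:
  fixes A :: "'a::real_normed_vector \<Rightarrow> real ^ 'n ^ 'n::finite"
  assumes S: "open S" "x \<in> S"
    and inv: "\<And>y. y \<in> S \<Longrightarrow> det (A y) \<noteq> 0"
    and sol: "\<And>y. y \<in> S \<Longrightarrow> A y *v z y = b y"
    and A: "\<And>i j. (\<lambda>y. A y $ i $ j) differentiable (at x)"
    and b: "\<And>i. (\<lambda>y. b y $ i) differentiable (at x)"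
  shows "z differentiable (at x)"
proof (rule differentiable_vec_componentwise)
  fix k
  define C where "C y = (\<chi> i j. if j = k then b y $ i else A y $ i $ j)" for y
  have C: "(\<lambda>y. C y $ i $ j) differentiable (at x)" for i j
    using A b by (cases "j = k") (auto simp: C_def)
  have "(\<lambda>y. det (C y) / det (A y)) differentiable (at x)"
    using inv[OF S(2)] by (intro differentiable_divide differentiable_det C A)
  moreover have "det (C y) / det (A y) = z y $ k" if "y \<in> S" for y
    using cramer[OF inv[OF that], of "z y" "b y"] sol[OF that] by (simp add: C_def)
  ultimately show "(\<lambda>y. z y $ k) differentiable (at x)"
    unfolding differentiable_def using S has_derivative_transform_within_open by (metis (no_types, lifting))
qed

lemma linear_axis_expansion:
  fixes f :: "real ^ 'n::finite \<Rightarrow> 'b::real_vector"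
  assumes "linear f"
  shows "f z = (\<Sum>j\<in>UNIV. z $ j *\<^sub>R f (axis j 1))"
proof -
  have "f z = f (\<Sum>j\<in>UNIV. z $ j *\<^sub>R axis j 1)"
    using basis_expansion[of z] by (simp add: scalar_mult_eq_scaleR)
  also have "\<dots> = (\<Sum>j\<in>UNIV. z $ j *\<^sub>R f (axis j 1))"
    by (simp add: linear_sum[OF assms] linear_cmul[OF assms])
  finally show ?thesis .
qed

section \<open>Smoothness within a set and on open sets\<close>

lemma frechet_derivative_cong_on:
  assumes "x \<in> S" "\<And>y. y \<in> S \<Longrightarrow> f y = g y"
  shows "frechet_derivative f (at x within S) = frechet_derivative g (at x within S)"
proof -
  \<comment> \<open>\<open>frechet_derivative\<close> is a choice among the derivatives, so it is
    enough that both functions have the same derivatives, whether or not there are any.\<close>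
  have "(f has_derivative D) (at x within S) \<longleftrightarrow> (g has_derivative D) (at x within S)" for D
    using has_derivative_transform[of x S f g D] has_derivative_transform[of x S g f D] assms by auto
  then show ?thesis by (simp add: frechet_derivative_def)
qed

lemma Ck_on_cong:
  assumes "\<And>y. y \<in> S \<Longrightarrow> f y = g y"
  shows "Ck_on k S f \<longleftrightarrow> Ck_on k S g"
  using assms
proof (induction k arbitrary: f g)
  case 0
  then show ?case by (auto intro: continuous_on_cong)
next
  case (Suc k)
  have "Ck_on k S (\<lambda>x. frechet_derivative f (at x within S) v)
      \<longleftrightarrow> Ck_on k S (\<lambda>x. frechet_derivative g (at x within S) v)" for v
    by (rule Suc.IH) (simp add: frechet_derivative_cong_on[of _ S f g] Suc.prems)
  moreover have "f differentiable_on S \<longleftrightarrow> g differentiable_on S"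
    using Suc.prems unfolding differentiable_on_def differentiable_def
    by (metis has_derivative_transform)
  ultimately show ?case by simp
qed

lemma smooth_on_differentiable_on: "smooth_on S f \<Longrightarrow> f differentiable_on S"
  unfolding smooth_on_def by (drule spec[of _ "Suc 0"]) simp

lemma smooth_on_has_derivative:
  assumes "open S" "smooth_on S f" "x \<in> S"
  shows "(f has_derivative frechet_derivative f (at x)) (at x)"
  using smooth_on_differentiable_on[OF assms(2)] assms
  by (simp add: differentiable_on_def at_within_open[OF _ assms(1)] frechet_derivative_works)

lemma smooth_on_frechet_derivative:
  assumes "open S" "smooth_on S f"
  shows "smooth_on S (\<lambda>x. frechet_derivative f (at x) v)"
  unfolding smooth_on_def
proof
  fix k
  \<comment> \<open>The recursion of \<open>Ck_on\<close> differentiates within \<open>S\<close>; on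
    the open set \<open>S\<close> this agrees with the unrestricted derivative.\<close>
  have "Ck_on k S (\<lambda>x. frechet_derivative f (at x within S) v)"
    using spec[OF assms(2)[unfolded smooth_on_def], of "Suc k"] by simp
  then show "Ck_on k S (\<lambda>x. frechet_derivative f (at x) v)"
    using Ck_on_cong[of S "\<lambda>x. frechet_derivative f (at x within S) v"
        "\<lambda>x. frechet_derivative f (at x) v" k]
    by (simp add: at_within_open[OF _ assms(1)])
qed

lemma smooth_on_continuous_on: "smooth_on S f \<Longrightarrow> continuous_on S f"
  unfolding smooth_on_def by (drule spec[of _ 0]) simp

section \<open>Riemannian metrics on open subsets of Euclidean space\<close>

text \<open>A metric in the coordinates of a single chart. Connection and curvature are studied here
  first; \<open>chart_metric\<close> then makes every chart an instance.\<close>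

locale local_riemannian_metric =
  fixes S :: "(real ^ 'n::finite) set"
    and g :: "real ^ 'n \<Rightarrow> real ^ 'n \<Rightarrow> real ^ 'n \<Rightarrow> real"
  assumes open_domain: "open S"
    and bilinear_metric: "x \<in> S \<Longrightarrow> bilinear (g x)"
    and metric_sym: "x \<in> S \<Longrightarrow> g x u v = g x v u"
    and metric_pos: "x \<in> S \<Longrightarrow> u \<noteq> 0 \<Longrightarrow> g x u u > 0"
    and smooth_metric: "smooth_on S (\<lambda>x. g x u v)"
begin

definition dg :: "real ^ 'n \<Rightarrow> real ^ 'n \<Rightarrow> real ^ 'n \<Rightarrow> real ^ 'n \<Rightarrow> real" where
  "dg x u v w = frechet_derivative (\<lambda>y. g y v w) (at x) u"

definition levi_civita :: "real ^ 'n \<Rightarrow> (real ^ 'n \<Rightarrow> real ^ 'n \<Rightarrow> real ^ 'n) \<Rightarrow> bool" where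
  "levi_civita x G \<longleftrightarrow> bilinear G \<and> (\<forall>u v. G u v = G v u) \<and>
     (\<forall>u v w. dg x u v w = g x (G u v) w + g x v (G u w))"

text \<open>The description has the same form as that of \<open>christoffel\<close>, so that in a
  chart the two agree by unfolding.\<close>

definition \<Gamma> :: "real ^ 'n \<Rightarrow> real ^ 'n \<Rightarrow> real ^ 'n \<Rightarrow> real ^ 'n" where
  "\<Gamma> x = (THE G. levi_civita x G)"

text \<open>The right side of the Koszul formula for constant fields, whose Lie brackets vanish: the
  Christoffel symbols of the first kind.\<close>

definition koszul :: "real ^ 'n \<Rightarrow> real ^ 'n \<Rightarrow> real ^ 'n \<Rightarrow> real ^ 'n \<Rightarrow> real" where
  "koszul x u v w = (dg x u v w + dg x v u w - dg x w u v) / 2"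

text \<open>The vector R(u, v)w, with the three arguments extended by constant fields.\<close>

definition Riem :: "real ^ 'n \<Rightarrow> real ^ 'n \<Rightarrow> real ^ 'n \<Rightarrow> real ^ 'n \<Rightarrow> real ^ 'n" where
  "Riem x u v w = frechet_derivative (\<lambda>y. \<Gamma> y v w) (at x) u
     - frechet_derivative (\<lambda>y. \<Gamma> y u w) (at x) v + \<Gamma> x u (\<Gamma> x v w) - \<Gamma> x v (\<Gamma> x u w)"

section \<open>Derivatives of the metric coefficients and the Koszul expression\<close>

lemma metric_linear_left: "x \<in> S \<Longrightarrow> linear (\<lambda>u. g x u v)"
  and metric_linear_right: "x \<in> S \<Longrightarrow> linear (\<lambda>v. g x u v)"
  using bilinear_metric by (auto simp: bilinear_def)

lemma has_derivative_metric: "x \<in> S \<Longrightarrow> ((\<lambda>y. g y v w) has_derivative (\<lambda>u. dg x u v w)) (at x)"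
  unfolding dg_def using smooth_on_has_derivative[OF open_domain smooth_metric] by simp

lemma smooth_dg: "smooth_on S (\<lambda>x. dg x u v w)"
  unfolding dg_def by (rule smooth_on_frechet_derivative[OF open_domain smooth_metric])

lemma differentiable_dg: "x \<in> S \<Longrightarrow> (\<lambda>y. dg y u v w) differentiable (at x)"
  using smooth_on_has_derivative[OF open_domain smooth_dg] differentiableI by blast

text \<open>Symmetry and linearity of \<open>dg\<close> in its metric arguments are obtained by
  exhibiting a derivative and invoking its uniqueness.\<close>

lemma dg_unique:
  assumes "x \<in> S" "((\<lambda>y. g y v w) has_derivative D) (at x)"
  shows "dg x u v w = D u"
  using has_derivative_unique[OF has_derivative_metric[OF assms(1)] assms(2)] by meson

lemma dg_sym: "x \<in> S \<Longrightarrow> dg x u v w = dg x u w v"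
  by (rule dg_unique[OF _ has_derivative_transform_within_open[OF has_derivative_metric open_domain]])
     (auto simp: metric_sym)

lemma dg_linear1: "x \<in> S \<Longrightarrow> linear (\<lambda>u. dg x u v w)"
  using has_derivative_metric has_derivative_linear by blast

lemma dg_linear2:
  assumes x: "x \<in> S"
  shows "linear (\<lambda>v. dg x u v w)"
proof
  fix v v'
  have "((\<lambda>y. g y v w + g y v' w) has_derivative (\<lambda>u. dg x u v w + dg x u v' w)) (at x)"
    by (intro has_derivative_add has_derivative_metric x)
  then have "((\<lambda>y. g y (v + v') w) has_derivative (\<lambda>u. dg x u v w + dg x u v' w)) (at x)"
    by (rule has_derivative_transform_within_open[OF _ open_domain x])
       (simp add: linear_add[OF metric_linear_left])
  then show "dg x u (v + v') w = dg x u v w + dg x u v' w"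
    by (rule dg_unique[OF x])
next
  fix a v
  have "((\<lambda>y. a *\<^sub>R g y v w) has_derivative (\<lambda>u. a *\<^sub>R dg x u v w)) (at x)"
    by (intro has_derivative_scaleR_right has_derivative_metric x)
  then have "((\<lambda>y. g y (a *\<^sub>R v) w) has_derivative (\<lambda>u. a *\<^sub>R dg x u v w)) (at x)"
    by (rule has_derivative_transform_within_open[OF _ open_domain x])
       (simp add: linear_cmul[OF metric_linear_left])
  then show "dg x u (a *\<^sub>R v) w = a *\<^sub>R dg x u v w"
    by (rule dg_unique[OF x])
qed

lemma dg_linear3:
  assumes x: "x \<in> S"
  shows "linear (\<lambda>w. dg x u v w)"
proof -
  have "(\<lambda>w. dg x u v w) = (\<lambda>w. dg x u w v)" using dg_sym[OF x] by blast
  then show ?thesis using dg_linear2[OF x] by simp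
qed

lemma koszul_sym: "x \<in> S \<Longrightarrow> koszul x u v w = koszul x v u w"
  unfolding koszul_def by (subst dg_sym[of x w u v]) simp_all

lemma koszul_linear1: "x \<in> S \<Longrightarrow> linear (\<lambda>u. koszul x u v w)"
  unfolding koszul_def
  by (rule linearI)
     (simp_all add: linear_add[OF dg_linear1] linear_add[OF dg_linear2] linear_cmul[OF dg_linear1]
       linear_cmul[OF dg_linear2] algebra_simps add_divide_distrib diff_divide_distrib)

lemma koszul_linear3: "x \<in> S \<Longrightarrow> linear (\<lambda>w. koszul x u v w)"
  unfolding koszul_def
  by (rule linearI)
     (simp_all add: linear_add[OF dg_linear1] linear_add[OF dg_linear3] linear_cmul[OF dg_linear1]
       linear_cmul[OF dg_linear3] algebra_simps add_divide_distrib diff_divide_distrib)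

lemma metric_nondegenerate:
  assumes x: "x \<in> S" and eq: "\<And>w. g x u w = g x v w"
  shows "u = v"
proof (rule ccontr)
  assume "u \<noteq> v"
  then have "g x (u - v) (u - v) > 0" using metric_pos[OF x] by simp
  then show False using eq linear_diff[OF metric_linear_left[OF x]] by simp
qed

text \<open>The column index belongs to the first argument of \<open>g\<close>, so that
  \<open>gram x *v z\<close> lists the products of \<open>z\<close> with the standard basis.\<close>

definition gram :: "real ^ 'n \<Rightarrow> real ^ 'n ^ 'n" where
  "gram x = (\<chi> i j. g x (axis j 1) (axis i 1))"

lemma gram_mult:
  assumes "x \<in> S"
  shows "gram x *v z = (\<chi> i. g x z (axis i 1))"
  using linear_axis_expansion[OF metric_linear_left[OF assms], of z]
  by (simp add: gram_def matrix_vector_mult_def vec_eq_iff mult.commute)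

text \<open>Two linear functionals that agree on the standard basis are equal. This turns an
  equation between functionals into a linear system with matrix \<open>gram x\<close>.\<close>

lemma metric_eq_functional:
  assumes x: "x \<in> S" and k: "linear k" and eq: "gram x *v z = (\<chi> i. k (axis i 1))"
  shows "g x z w = k w"
proof -
  have "g x z (axis i 1) = k (axis i 1)" for i
    using eq unfolding gram_mult[OF x] by (simp add: vec_eq_iff)
  then show ?thesis
    using linear_axis_expansion[OF metric_linear_right[OF x], of z w] linear_axis_expansion[OF k, of w]
    by simp
qed

text \<open>A vector in the kernel is orthogonal to every vector, in particular to itself, and
  positivity makes it 0.\<close>

lemma det_gram_nonzero:
  assumes x: "x \<in> S"
  shows "det (gram x) \<noteq> 0"
proof -
  have "z = 0" if "gram x *v z = 0" for z
  proof -
    have "g x z w = 0" for w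
      by (rule metric_eq_functional[OF x, of "\<lambda>_. 0"]) (use that in \<open>auto simp: vec_eq_iff linear_iff\<close>)
    then show "z = 0" using metric_pos[OF x] by force
  qed
  then show ?thesis
    using matrix_left_invertible_ker invertible_left_inverse invertible_det_nz by metis
qed

lemma metric_represents:
  assumes x: "x \<in> S" and k: "linear k"
  obtains z where "\<And>w. g x z w = k w"
proof -
  obtain z where "gram x *v z = (\<chi> i. k (axis i 1))"
    using cramer[OF det_gram_nonzero[OF x], of _ "\<chi> i. k (axis i 1)"] by blast
  then show ?thesis using metric_eq_functional[OF x k] that by blast
qed

text \<open>Expand the three derivatives in \<open>koszul\<close> by compatibility with the metric.
  By the symmetry of \<open>G\<close> four of the six terms cancel in pairs and the other two
  coincide. This gives the uniqueness of the connection.\<close>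

lemma levi_civita_koszul:
  assumes x: "x \<in> S" and G: "levi_civita x G"
  shows "g x (G u v) w = koszul x u v w"
proof -
  have G_sym: "G a b = G b a" for a b
    using G unfolding levi_civita_def by blast
  have compat: "dg x a b c = g x (G a b) c + g x (G a c) b" for a b c
    using G metric_sym[OF x, of b] unfolding levi_civita_def by metis
  show ?thesis
    unfolding koszul_def compat[of u v w] compat[of v u w] compat[of w u v]
    unfolding G_sym[of v u] G_sym[of w u] G_sym[of w v] by simp
qed

text \<open>\<open>G u v\<close> is the vector that represents the functional
  \<open>koszul x u v\<close>. Its symmetry and linearity are inherited from \<open>koszul\<close>
  by nondegeneracy.\<close>

lemma levi_civita_exists:
  assumes x: "x \<in> S"
  shows "\<exists>G. levi_civita x G"
proof -
  have "\<exists>z. \<forall>w. g x z w = koszul x u v w" for u v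
    using metric_represents[OF x koszul_linear3[OF x]] by metis
  then obtain G where G: "\<And>u v w. g x (G u v) w = koszul x u v w" by metis
  have sym: "G u v = G v u" for u v
    by (rule metric_nondegenerate[OF x]) (simp add: G koszul_sym[OF x, of u])
  have lin: "linear (\<lambda>u. G u v)" for v
    by (intro linearI metric_nondegenerate[OF x])
       (simp_all add: G linear_add[OF metric_linear_left[OF x]] linear_cmul[OF metric_linear_left[OF x]]
         linear_add[OF koszul_linear1[OF x]] linear_cmul[OF koszul_linear1[OF x]])
  have "(\<lambda>v. G u v) = (\<lambda>v. G v u)" for u using sym by blast
  with lin have "bilinear G" unfolding bilinear_def by metis
  \<comment> \<open>In \<open>koszul x u v w + koszul x u w v\<close> only the derivatives in
    direction \<open>u\<close> survive.\<close>
  moreover have "dg x u v w = g x (G u v) w + g x v (G u w)" for u v w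
    unfolding metric_sym[OF x, of v "G u w"] G koszul_def
    unfolding dg_sym[OF x, of u w v] by (simp add: field_simps)
  ultimately show ?thesis unfolding levi_civita_def using sym by blast
qed

lemma levi_civita_\<Gamma>:
  assumes x: "x \<in> S"
  shows "levi_civita x (\<Gamma> x)"
proof -
  have "G = G'" if "levi_civita x G" "levi_civita x G'" for G G'
    by (intro ext metric_nondegenerate[OF x]) (simp add: levi_civita_koszul[OF x] that)
  then show ?thesis
    unfolding \<Gamma>_def using levi_civita_exists[OF x] by (metis theI)
qed

lemma \<Gamma>_bilinear: "x \<in> S \<Longrightarrow> bilinear (\<Gamma> x)"
  and metric_compatible: "x \<in> S \<Longrightarrow> dg x u v w = g x (\<Gamma> x u v) w + g x v (\<Gamma> x u w)"
  using levi_civita_\<Gamma>[of x] by (simp_all add: levi_civita_def)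

lemma \<Gamma>_linear1: "x \<in> S \<Longrightarrow> linear (\<lambda>u. \<Gamma> x u v)"
  and \<Gamma>_linear2: "x \<in> S \<Longrightarrow> linear (\<lambda>v. \<Gamma> x u v)"
  using \<Gamma>_bilinear by (auto simp: bilinear_def)

lemma \<Gamma>_zero_left: "x \<in> S \<Longrightarrow> \<Gamma> x 0 v = 0"
  using linear_0[OF \<Gamma>_linear1] .

text \<open>\<open>\<Gamma> y u v\<close> solves a linear system whose matrix is the Gram matrix and
  whose right side is the Koszul functional on the standard basis; both have differentiable
  entries.\<close>

lemma differentiable_\<Gamma>:
  assumes x: "x \<in> S"
  shows "(\<lambda>y. \<Gamma> y u v) differentiable (at x)"
proof (rule differentiable_solution_linear_system[OF open_domain x det_gram_nonzero])
  show "gram y *v \<Gamma> y u v = (\<chi> i. koszul y u v (axis i 1))" if "y \<in> S" for y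
    unfolding gram_mult[OF that] using levi_civita_koszul[OF that levi_civita_\<Gamma>[OF that]] by simp
  show "(\<lambda>y. gram y $ i $ j) differentiable (at x)" for i j
    unfolding gram_def using differentiableI[OF has_derivative_metric[OF x]] by simp
  show "(\<lambda>y. (\<chi> i. koszul y u v (axis i 1)) $ i) differentiable (at x)" for i
    unfolding koszul_def vec_lambda_beta
    by (intro differentiable_divide differentiable_add differentiable_diff differentiable_const
        differentiable_dg x) simp
qed

text \<open>The derivative of \<open>g\<close> is at hand for constant arguments only. Expanding
  \<open>Y\<close> in the standard basis reduces the claim to the product rule.\<close>

lemma has_derivative_metric_field:
  assumes x: "x \<in> S" and Y: "(Y has_derivative Y') (at x)"
  shows "((\<lambda>y. g y (Y y) w) has_derivative (\<lambda>h. dg x h (Y x) w + g x (Y' h) w)) (at x)"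
proof -
  have "((\<lambda>y. \<Sum>j\<in>UNIV. Y y $ j * g y (axis j 1) w) has_derivative
      (\<lambda>h. \<Sum>j\<in>UNIV. Y x $ j * dg x h (axis j 1) w + Y' h $ j * g x (axis j 1) w)) (at x)"
    by (intro has_derivative_sum has_derivative_mult has_derivative_metric[OF x]
        bounded_linear.has_derivative[OF bounded_linear_vec_nth Y])
  moreover have "(\<lambda>h. \<Sum>j\<in>UNIV. Y x $ j * dg x h (axis j 1) w + Y' h $ j * g x (axis j 1) w)
      = (\<lambda>h. dg x h (Y x) w + g x (Y' h) w)"
    (is "?l = ?r")
  proof
    show "?l h = ?r h" for h
      using linear_axis_expansion[OF dg_linear2[OF x], of h "Y x" w]
        linear_axis_expansion[OF metric_linear_left[OF x], of "Y' h" w]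
      by (simp add: sum.distrib)
  qed
  ultimately have "((\<lambda>y. \<Sum>j\<in>UNIV. Y y $ j * g y (axis j 1) w) has_derivative
      (\<lambda>h. dg x h (Y x) w + g x (Y' h) w)) (at x)"
    by simp
  then show ?thesis
  proof (rule has_derivative_transform_within_open[OF _ open_domain x])
    show "(\<Sum>j\<in>UNIV. Y y $ j * g y (axis j 1) w) = g y (Y y) w" if "y \<in> S" for y
      using linear_axis_expansion[OF metric_linear_left[OF that], of "Y y" w] by simp
  qed
qed

section \<open>Algebraic symmetries of the curvature tensor\<close>

lemma Riem_antisym: "Riem x v u w = - Riem x u v w"
  by (simp add: Riem_def)

text \<open>The argument \<open>u\<close> occurs as a direction of differentiation and also inside a
  differentiated function. For the second occurrence, linearity of \<open>\<Gamma>\<close> on the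
  whole domain is carried over to its derivative.\<close>

lemma Riem_linear1:
  assumes x: "x \<in> S"
  shows "linear (\<lambda>u. Riem x u v w)"
proof -
  have d: "((\<lambda>y. \<Gamma> y u w) has_derivative frechet_derivative (\<lambda>y. \<Gamma> y u w) (at x)) (at x)" for u
    using differentiable_\<Gamma>[OF x] frechet_derivative_works by blast
  have lin: "linear (frechet_derivative (\<lambda>y. \<Gamma> y v w) (at x))"
    using d has_derivative_linear by blast
  have add: "frechet_derivative (\<lambda>y. \<Gamma> y (u + u') w) (at x) v
      = frechet_derivative (\<lambda>y. \<Gamma> y u w) (at x) v + frechet_derivative (\<lambda>y. \<Gamma> y u' w) (at x) v" for u u'
  proof -
    have "((\<lambda>y. \<Gamma> y (u + u') w) has_derivative (\<lambda>v. frechet_derivative (\<lambda>y. \<Gamma> y u w) (at x) v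
        + frechet_derivative (\<lambda>y. \<Gamma> y u' w) (at x) v)) (at x)"
      by (rule has_derivative_transform_within_open[OF has_derivative_add[OF d d] open_domain x])
         (simp add: linear_add[OF \<Gamma>_linear1])
    from fun_cong[OF frechet_derivative_at[OF this], of v] show ?thesis by simp
  qed
  have scale: "frechet_derivative (\<lambda>y. \<Gamma> y (a *\<^sub>R u) w) (at x) v
      = a *\<^sub>R frechet_derivative (\<lambda>y. \<Gamma> y u w) (at x) v" for a u
  proof -
    have "((\<lambda>y. \<Gamma> y (a *\<^sub>R u) w) has_derivative
        (\<lambda>v. a *\<^sub>R frechet_derivative (\<lambda>y. \<Gamma> y u w) (at x) v)) (at x)"
      by (rule has_derivative_transform_within_open[OF has_derivative_scaleR_right[OF d] open_domain x])
         (simp add: linear_cmul[OF \<Gamma>_linear1])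
    from fun_cong[OF frechet_derivative_at[OF this], of v] show ?thesis by simp
  qed
  show ?thesis
    by (rule linearI)
       (simp_all add: Riem_def add scale linear_add[OF lin] linear_cmul[OF lin]
         linear_add[OF \<Gamma>_linear1[OF x]] linear_cmul[OF \<Gamma>_linear1[OF x]]
         linear_add[OF \<Gamma>_linear2[OF x]] linear_cmul[OF \<Gamma>_linear2[OF x]] algebra_simps)
qed

text \<open>
  Antisymmetrizing the second derivatives of the function \<open>g(w, w)\<close>, whose first derivative in
  direction \<open>v\<close> is \<open>2 g(\<Gamma>(v, w), w)\<close>.
\<close>

lemma Riem_skew:
  assumes x: "x \<in> S"
  shows "g x (Riem x u v w) w = 0"
proof -
  define D where "D u v = frechet_derivative (\<lambda>y. \<Gamma> y v w) (at x) u" for u v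
  have first: "dg y v w w = 2 * g y (\<Gamma> y v w) w" if "y \<in> S" for y v
    using metric_compatible[OF that, of v w w] metric_sym[OF that] by simp
  have d: "((\<lambda>y. \<Gamma> y v w) has_derivative (\<lambda>u. D u v)) (at x)" for v
    unfolding D_def using differentiable_\<Gamma>[OF x] frechet_derivative_works by fastforce
  have second: "frechet_derivative (\<lambda>y. dg y v w w) (at x) u
      = 2 * (g x (\<Gamma> x u (\<Gamma> x v w)) w + g x (\<Gamma> x v w) (\<Gamma> x u w) + g x (D u v) w)" for u v
  proof -
    have "((\<lambda>y. 2 * g y (\<Gamma> y v w) w) has_derivative
        (\<lambda>u. 2 * (dg x u (\<Gamma> x v w) w + g x (D u v) w))) (at x)"
      by (intro has_derivative_mult_right has_derivative_metric_field x d)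
    then have "((\<lambda>y. dg y v w w) has_derivative
        (\<lambda>u. 2 * (dg x u (\<Gamma> x v w) w + g x (D u v) w))) (at x)"
      by (rule has_derivative_transform_within_open[OF _ open_domain x]) (simp add: first)
    from fun_cong[OF frechet_derivative_at[OF this], of u] show ?thesis
      by (simp add: metric_compatible[OF x])
  qed
  have "frechet_derivative (\<lambda>y. dg y v w w) (at x) u = frechet_derivative (\<lambda>y. dg y u w w) (at x) v"
    by (rule mixed_second_derivatives_eq[OF open_domain x, where f = "\<lambda>y. g y w w"
          and f' = "\<lambda>y v. dg y v w w" and f'' = "\<lambda>v y. frechet_derivative (\<lambda>y. dg y v w w) (at y)"])
       (auto intro: has_derivative_metric smooth_on_has_derivative[OF open_domain smooth_dg]
          smooth_on_continuous_on smooth_on_frechet_derivative[OF open_domain smooth_dg])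
  \<comment> \<open>The products of \<open>\<Gamma> x v w\<close> with \<open>\<Gamma> x u w\<close>
    are symmetric in \<open>u\<close> and \<open>v\<close> and drop out; what remains is the product
    of the curvature with \<open>w\<close>.\<close>
  then have "g x (\<Gamma> x u (\<Gamma> x v w)) w + g x (D u v) w - g x (\<Gamma> x v (\<Gamma> x u w)) w - g x (D v u) w = 0"
    unfolding second using metric_sym[OF x, of "\<Gamma> x v w" "\<Gamma> x u w"] by simp
  then show ?thesis
    unfolding Riem_def D_def[symmetric]
    by (simp add: linear_add[OF metric_linear_left[OF x]] linear_diff[OF metric_linear_left[OF x]])
qed

end

section \<open>Tangent vectors and curvature in charts\<close>

definition jacobian :: "('m, 'n::finite) chart \<Rightarrow> ('m, 'n) chart \<Rightarrow> 'm \<Rightarrow> real ^ 'n \<Rightarrow> real ^ 'n" where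
  "jacobian c d p = frechet_derivative (transition c d) (at (snd c p))"

locale riemannian =
  fixes M :: "('m, 'n::finite) riem"
  assumes manifold: "smooth_manifold M" and riemannian: "riemannian_metric M"
begin

section \<open>Charts and coordinate changes\<close>

lemma chart_is_chart: "c \<in> atlas M \<Longrightarrow> is_chart (mtop M) c"
  using manifold by (simp add: smooth_manifold_def)

lemma chart_openin: "c \<in> atlas M \<Longrightarrow> openin (mtop M) (fst c)"
  and chart_image_open: "c \<in> atlas M \<Longrightarrow> open (snd c ` fst c)"
  using chart_is_chart by (simp_all add: is_chart_def)

lemma topspace_subtopology_chart: "c \<in> atlas M \<Longrightarrow> topspace (subtopology (mtop M) (fst c)) = fst c"
  by (rule topspace_subtopology_subset[OF openin_subset[OF chart_openin]])

lemma chart_inj: "c \<in> atlas M \<Longrightarrow> inj_on (snd c) (fst c)"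
  using homeomorphic_imp_injective_map[of "subtopology (mtop M) (fst c)" "top_of_set (snd c ` fst c)" "snd c"]
    chart_is_chart[of c] topspace_subtopology_chart[of c]
  by (simp add: is_chart_def)

lemma chart_inv_chart: "c \<in> atlas M \<Longrightarrow> p \<in> fst c \<Longrightarrow> chart_inv c (snd c p) = p"
  using chart_inj by (simp add: chart_inv_def)

lemma transition_chart: "c \<in> atlas M \<Longrightarrow> p \<in> fst c \<Longrightarrow> transition c d (snd c p) = snd d p"
  by (simp add: transition_def chart_inv_chart)

text \<open>A chart is an open map onto an open set, so relatively open images are open. Hence
  transition maps live on open sets and have full derivatives there.\<close>

lemma overlap_open:
  assumes c: "c \<in> atlas M" and U: "openin (mtop M) U"
  shows "open (snd c ` (fst c \<inter> U))"
proof -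
  have "open_map (subtopology (mtop M) (fst c)) (top_of_set (snd c ` fst c)) (snd c)"
    using chart_is_chart[OF c] homeomorphic_imp_open_map by (auto simp: is_chart_def)
  moreover have "openin (subtopology (mtop M) (fst c)) (fst c \<inter> U)"
    using U by (auto simp: openin_subtopology)
  ultimately have "openin (top_of_set (snd c ` fst c)) (snd c ` (fst c \<inter> U))"
    by (auto simp: open_map_def)
  then show ?thesis
    using chart_image_open[OF c] openin_open_trans by blast
qed

lemma charts_atD: "c \<in> charts_at M p \<Longrightarrow> c \<in> atlas M" "c \<in> charts_at M p \<Longrightarrow> p \<in> fst c"
  by (simp_all add: charts_at_def)

lemma transition_has_derivative:
  assumes c: "c \<in> charts_at M p" and d: "d \<in> charts_at M p"
  shows "(transition c d has_derivative jacobian c d p) (at (snd c p))"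
  unfolding jacobian_def
proof (rule smooth_on_has_derivative)
  show "open (snd c ` (fst c \<inter> fst d))"
    using overlap_open chart_openin c d charts_atD by blast
  show "smooth_on (snd c ` (fst c \<inter> fst d)) (transition c d)"
    using manifold c d charts_atD unfolding smooth_manifold_def by blast
  show "snd c p \<in> snd c ` (fst c \<inter> fst d)"
    using c d charts_atD by blast
qed

lemma jacobian_linear: "c \<in> charts_at M p \<Longrightarrow> d \<in> charts_at M p \<Longrightarrow> linear (jacobian c d p)"
  using transition_has_derivative has_derivative_linear by blast

lemma jacobian_self:
  assumes c: "c \<in> charts_at M p"
  shows "jacobian c c p u = u"
proof -
  have "((\<lambda>x. x) has_derivative jacobian c c p) (at (snd c p))"
    by (rule has_derivative_transform_within_open[OF transition_has_derivative[OF c c]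
          chart_image_open[OF charts_atD(1)[OF c]]])
       (use charts_atD[OF c] in \<open>auto simp: transition_chart\<close>)
  from has_derivative_unique[OF this has_derivative_ident] show ?thesis by simp
qed

text \<open>Chain rule: near \<open>snd c p\<close> the transition from \<open>c\<close> to
  \<open>e\<close> factors through \<open>d\<close>.\<close>

lemma jacobian_cocycle:
  assumes c: "c \<in> charts_at M p" and d: "d \<in> charts_at M p" and e: "e \<in> charts_at M p"
  shows "jacobian d e p (jacobian c d p u) = jacobian c e p u"
proof -
  have tc: "transition c d (snd c p) = snd d p"
    using c charts_atD transition_chart by blast
  have "(transition d e \<circ> transition c d has_derivative jacobian d e p \<circ> jacobian c d p) (at (snd c p))"
    by (rule diff_chain_at[OF transition_has_derivative[OF c d]])
       (simp add: tc transition_has_derivative[OF d e])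
  then have "(transition c e has_derivative jacobian d e p \<circ> jacobian c d p) (at (snd c p))"
  proof (rule has_derivative_transform_within_open)
    show "open (snd c ` (fst c \<inter> fst d))"
      using overlap_open chart_openin c d charts_atD by blast
    show "snd c p \<in> snd c ` (fst c \<inter> fst d)"
      using c d charts_atD by blast
    show "(transition d e \<circ> transition c d) x = transition c e x"
      if "x \<in> snd c ` (fst c \<inter> fst d)" for x
      using that charts_atD[OF c] charts_atD[OF d] by (auto simp: transition_chart)
  qed
  from fun_cong[OF has_derivative_unique[OF this transition_has_derivative[OF c e]], of u]
  show ?thesis by simp
qed

lemma coord_vec_apply: "d \<in> charts_at M p \<Longrightarrow> coord_vec M p c u d = jacobian c d p u"
  by (simp add: coord_vec_def jacobian_def)

lemma coord_vec_outside: "d \<notin> charts_at M p \<Longrightarrow> coord_vec M p c u d = 0"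
  by (simp add: coord_vec_def)

lemma coord_vec_self: "c \<in> charts_at M p \<Longrightarrow> coord_vec M p c u c = u"
  by (simp add: coord_vec_apply jacobian_self)

lemma coord_vec_lincomb:
  assumes c: "c \<in> charts_at M p"
  shows "coord_vec M p c (a *\<^sub>R u + b *\<^sub>R v) = (\<lambda>d. a *\<^sub>R coord_vec M p c u d + b *\<^sub>R coord_vec M p c v d)"
proof
  show "coord_vec M p c (a *\<^sub>R u + b *\<^sub>R v) d = a *\<^sub>R coord_vec M p c u d + b *\<^sub>R coord_vec M p c v d" for d
    by (cases "d \<in> charts_at M p")
       (simp_all add: coord_vec_apply coord_vec_outside linear_add[OF jacobian_linear[OF c]]
         linear_cmul[OF jacobian_linear[OF c]])
qed

section \<open>Tangent spaces\<close>

lemma tangent_space_iff: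
  "V \<in> tangent_space M p \<longleftrightarrow>
    (\<forall>c\<in>charts_at M p. \<forall>d\<in>charts_at M p. V d = jacobian c d p (V c)) \<and>
    (\<forall>c. c \<notin> charts_at M p \<longrightarrow> V c = 0)"
  by (simp add: tangent_space_def jacobian_def)

lemma tangent_coordinates:
  "V \<in> tangent_space M p \<Longrightarrow> c \<in> charts_at M p \<Longrightarrow> d \<in> charts_at M p \<Longrightarrow> V d = jacobian c d p (V c)"
  unfolding tangent_space_iff by blast

lemma tangent_outside: "V \<in> tangent_space M p \<Longrightarrow> c \<notin> charts_at M p \<Longrightarrow> V c = 0"
  unfolding tangent_space_iff by blast

lemma coord_vec_tangent: "c \<in> charts_at M p \<Longrightarrow> coord_vec M p c u \<in> tangent_space M p"
  by (simp add: tangent_space_iff coord_vec_apply coord_vec_outside jacobian_cocycle)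

text \<open>Together with \<open>coord_vec_self\<close> and \<open>coord_vec_tangent\<close>, this
  identifies the tangent space with Euclidean space through any chart at \<open>p\<close>.\<close>

lemma coord_vec_coordinates:
  assumes "V \<in> tangent_space M p" "c \<in> charts_at M p"
  shows "coord_vec M p c (V c) = V"
proof
  show "coord_vec M p c (V c) d = V d" for d
    by (cases "d \<in> charts_at M p")
       (simp_all add: tangent_coordinates[OF assms, of d] tangent_outside[OF assms(1)]
         coord_vec_apply coord_vec_outside)
qed

lemma tangent_lincomb:
  assumes "V \<in> tangent_space M p" "W \<in> tangent_space M p"
  shows "(\<lambda>d. a *\<^sub>R V d + b *\<^sub>R W d) \<in> tangent_space M p"
  unfolding tangent_space_iff
proof (intro conjI ballI allI impI)
  fix c d assume cd: "c \<in> charts_at M p" "d \<in> charts_at M p"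
  show "a *\<^sub>R V d + b *\<^sub>R W d = jacobian c d p (a *\<^sub>R V c + b *\<^sub>R W c)"
    by (simp add: linear_add[OF jacobian_linear[OF cd]] linear_cmul[OF jacobian_linear[OF cd]]
        tangent_coordinates[OF assms(1) cd] tangent_coordinates[OF assms(2) cd])
qed (simp add: tangent_outside[OF assms(1)] tangent_outside[OF assms(2)])

lemma zero_tangent: "(\<lambda>_. 0) \<in> tangent_space M p"
  by (auto simp: tangent_space_iff linear_0[OF jacobian_linear])

section \<open>The metric on tangent spaces and in charts\<close>

lemma metric_comm:
  "p \<in> topspace (mtop M) \<Longrightarrow> V \<in> tangent_space M p \<Longrightarrow> W \<in> tangent_space M p \<Longrightarrow>
    metric M p V W = metric M p W V"
  using riemannian unfolding riemannian_metric_def by blast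

lemma metric_add_scale:
  "p \<in> topspace (mtop M) \<Longrightarrow> U \<in> tangent_space M p \<Longrightarrow> V \<in> tangent_space M p \<Longrightarrow>
    W \<in> tangent_space M p \<Longrightarrow>
    metric M p (\<lambda>c. a *\<^sub>R U c + V c) W = a * metric M p U W + metric M p V W"
  using riemannian unfolding riemannian_metric_def by blast

lemma metric_positive:
  "p \<in> topspace (mtop M) \<Longrightarrow> V \<in> tangent_space M p \<Longrightarrow> V \<noteq> (\<lambda>_. 0) \<Longrightarrow> metric M p V V > 0"
  using riemannian unfolding riemannian_metric_def by blast

lemma metric_zero_left:
  assumes p: "p \<in> topspace (mtop M)" and W: "W \<in> tangent_space M p"
  shows "metric M p (\<lambda>_. 0) W = 0"
  using metric_add_scale[OF p zero_tangent zero_tangent W, of 1] by simp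

lemma metric_lincomb:
  assumes p: "p \<in> topspace (mtop M)" and U: "U \<in> tangent_space M p"
    and V: "V \<in> tangent_space M p" and W: "W \<in> tangent_space M p"
  shows "metric M p (\<lambda>c. a *\<^sub>R U c + b *\<^sub>R V c) W = a * metric M p U W + b * metric M p V W"
proof -
  have "(\<lambda>c. b *\<^sub>R V c) \<in> tangent_space M p"
    using tangent_lincomb[OF V zero_tangent, of b 0] by simp
  moreover have "metric M p (\<lambda>c. b *\<^sub>R V c) W = b * metric M p V W"
    using metric_add_scale[OF p V zero_tangent W, of b] metric_zero_left[OF p W] by simp
  ultimately show ?thesis using metric_add_scale[OF p U _ W] by simp
qed

lemma local_metric_eq:
  assumes c: "c \<in> charts_at M p"
  shows "local_metric M c (snd c p) u v = metric M p (coord_vec M p c u) (coord_vec M p c v)"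
  using charts_atD[OF c] by (simp add: local_metric_def chart_inv_chart)

lemma chart_subset_topspace: "c \<in> atlas M \<Longrightarrow> p \<in> fst c \<Longrightarrow> p \<in> topspace (mtop M)"
  using chart_openin openin_subset by blast

text \<open>Symmetry, bilinearity and positivity are pulled back along \<open>coord_vec\<close>,
  which is linear and injective.\<close>

lemma chart_metric:
  assumes c: "c \<in> atlas M"
  shows "local_riemannian_metric (snd c ` fst c) (local_metric M c)"
proof
  show "open (snd c ` fst c)" by (rule chart_image_open[OF c])
  show "smooth_on (snd c ` fst c) (\<lambda>x. local_metric M c x u v)" for u v
    using riemannian c unfolding riemannian_metric_def by blast
  fix x assume "x \<in> snd c ` fst c"
  then obtain p where p: "p \<in> fst c" and x: "x = snd c p" by blast
  have top: "p \<in> topspace (mtop M)" using chart_subset_topspace[OF c p] .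
  have cp: "c \<in> charts_at M p" using c p by (simp add: charts_at_def)
  note eq = x local_metric_eq[OF cp]
  note tan = coord_vec_tangent[OF cp]
  show sym: "local_metric M c x u v = local_metric M c x v u" for u v
    unfolding eq by (rule metric_comm[OF top tan tan])
  have lin: "linear (\<lambda>u. local_metric M c x u v)" for v
  proof
    show "local_metric M c x (u + u') v = local_metric M c x u v + local_metric M c x u' v" for u u'
      using coord_vec_lincomb[OF cp, of 1 u 1 u'] metric_lincomb[OF top tan tan tan, of 1 u 1 u']
      by (simp add: eq)
    show "local_metric M c x (a *\<^sub>R u) v = a *\<^sub>R local_metric M c x u v" for a u
      using coord_vec_lincomb[OF cp, of a u 0 u] metric_lincomb[OF top tan tan tan, of a u 0 u]
      by (simp add: eq)
  qed
  moreover have "(\<lambda>v. local_metric M c x u v) = (\<lambda>v. local_metric M c x v u)" for u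
    using sym by blast
  ultimately show "bilinear (local_metric M c x)"
    unfolding bilinear_def by metis
  show "local_metric M c x u u > 0" if "u \<noteq> 0" for u
  proof -
    have "coord_vec M p c u \<noteq> (\<lambda>_. 0)"
      using coord_vec_self[OF cp, of u] that by metis
    then show ?thesis unfolding eq by (rule metric_positive[OF top tan])
  qed
qed

lemma metric_eq_local:
  assumes "c \<in> charts_at M p" "V \<in> tangent_space M p" "W \<in> tangent_space M p"
  shows "metric M p V W = local_metric M c (snd c p) (V c) (W c)"
  using assms by (simp add: local_metric_eq coord_vec_coordinates)

lemma christoffel_eq:
  assumes c: "c \<in> atlas M"
  shows "christoffel M c = local_riemannian_metric.\<Gamma> (local_metric M c)"
  unfolding christoffel_def[abs_def] levi_civita_at_def[abs_def]
    local_riemannian_metric.\<Gamma>_def[OF chart_metric[OF c], abs_def]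
    local_riemannian_metric.levi_civita_def[OF chart_metric[OF c], abs_def]
    local_riemannian_metric.dg_def[OF chart_metric[OF c], abs_def]
  ..

text \<open>Constant fields have zero bracket and zero derivative, so each inner covariant
  derivative is a Christoffel term and the bracket term is
  \<open>\<Gamma> x 0 w = 0\<close>.\<close>

lemma local_curvature_eq:
  assumes c: "c \<in> atlas M" and x: "x \<in> snd c ` fst c"
  shows "local_curvature M c (\<lambda>_. u) (\<lambda>_. v) (\<lambda>_. w) x
    = local_riemannian_metric.Riem (local_metric M c) x u v w"
proof -
  interpret local_riemannian_metric "snd c ` fst c" "local_metric M c"
    by (rule chart_metric[OF c])
  show ?thesis
    by (simp add: local_curvature_def local_nabla_def lie_bracket_def christoffel_eq[OF c]
        Riem_def \<Gamma>_zero_left[OF x])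
qed

lemma chart_at_charts_at:
  assumes "p \<in> topspace (mtop M)"
  shows "chart_at M p \<in> charts_at M p"
proof -
  have "\<exists>c. c \<in> charts_at M p"
    using assms manifold unfolding smooth_manifold_def charts_at_def by blast
  then show ?thesis unfolding chart_at_def by (rule someI_ex)
qed

section \<open>Curvature of the manifold\<close>

lemma curvature_eq:
  assumes p: "p \<in> topspace (mtop M)"
  shows "curvature M p X Y Z = (let c = chart_at M p in
    coord_vec M p c (local_riemannian_metric.Riem (local_metric M c) (snd c p) (X c) (Y c) (Z c)))"
  using charts_atD[OF chart_at_charts_at[OF p]]
  by (simp add: curvature_def Let_def local_curvature_eq)

lemma curvature_tangent:
  "p \<in> topspace (mtop M) \<Longrightarrow> curvature M p X Y Z \<in> tangent_space M p"
  by (simp add: curvature_eq Let_def coord_vec_tangent chart_at_charts_at)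

lemma chart_at_metric:
  assumes p: "p \<in> topspace (mtop M)"
  shows "local_riemannian_metric (snd (chart_at M p) ` fst (chart_at M p)) (local_metric M (chart_at M p))"
    and "snd (chart_at M p) p \<in> snd (chart_at M p) ` fst (chart_at M p)"
  using charts_atD[OF chart_at_charts_at[OF p]] by (simp_all add: chart_metric)

lemma curvature_swap:
  assumes p: "p \<in> topspace (mtop M)"
  shows "curvature M p Y X Z = (\<lambda>d. - curvature M p X Y Z d)"
proof -
  let ?c = "chart_at M p"
  interpret local_riemannian_metric "snd ?c ` fst ?c" "local_metric M ?c"
    by (rule chart_at_metric[OF p])
  show ?thesis
    using coord_vec_lincomb[OF chart_at_charts_at[OF p], of "-1" "Riem (snd ?c p) (X ?c) (Y ?c) (Z ?c)" 0 0]
    by (simp add: curvature_eq[OF p] Let_def Riem_antisym[of _ "Y ?c"])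
qed

lemma curvature_lincomb_left:
  assumes p: "p \<in> topspace (mtop M)"
  shows "curvature M p (\<lambda>c. a *\<^sub>R X c + b *\<^sub>R X' c) Y Z
    = (\<lambda>d. a *\<^sub>R curvature M p X Y Z d + b *\<^sub>R curvature M p X' Y Z d)"
proof -
  let ?c = "chart_at M p"
  interpret local_riemannian_metric "snd ?c ` fst ?c" "local_metric M ?c"
    by (rule chart_at_metric[OF p])
  show ?thesis
    by (simp add: curvature_eq[OF p] Let_def linear_add[OF Riem_linear1[OF chart_at_metric(2)[OF p]]]
        linear_cmul[OF Riem_linear1[OF chart_at_metric(2)[OF p]]]
        coord_vec_lincomb[OF chart_at_charts_at[OF p]])
qed

lemma curvature_lincomb_right:
  assumes p: "p \<in> topspace (mtop M)"
  shows "curvature M p X (\<lambda>c. a *\<^sub>R Y c + b *\<^sub>R Y' c) Z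
    = (\<lambda>d. a *\<^sub>R curvature M p X Y Z d + b *\<^sub>R curvature M p X Y' Z d)"
  unfolding curvature_swap[OF p, of X] curvature_lincomb_left[OF p] by (simp add: algebra_simps)

lemma curvature_skew:
  assumes p: "p \<in> topspace (mtop M)" and Z: "Z \<in> tangent_space M p"
  shows "metric M p (curvature M p X Y Z) Z = 0"
proof -
  let ?c = "chart_at M p"
  have c: "?c \<in> charts_at M p" by (rule chart_at_charts_at[OF p])
  interpret local_riemannian_metric "snd ?c ` fst ?c" "local_metric M ?c"
    by (rule chart_at_metric[OF p])
  have "metric M p (curvature M p X Y Z) Z
      = local_metric M ?c (snd ?c p) (Riem (snd ?c p) (X ?c) (Y ?c) (Z ?c)) (Z ?c)"
    unfolding metric_eq_local[OF c curvature_tangent[OF p] Z]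
    by (simp add: curvature_eq[OF p] Let_def coord_vec_self[OF c])
  also have "\<dots> = 0" by (rule Riem_skew[OF chart_at_metric(2)[OF p]])
  finally show ?thesis .
qed

end

section \<open>Covariant derivatives along curves\<close>

locale riemannian_curve = riemannian M for M :: "('m, 'n::finite) riem" +
  fixes I :: "real set" and \<gamma> :: "real \<Rightarrow> 'm"
  assumes curve: "smooth_curve M I \<gamma>"
begin

lemma curve_in_manifold: "t \<in> I \<Longrightarrow> \<gamma> t \<in> topspace (mtop M)"
  using curve by (auto simp: smooth_curve_def continuous_map_def)

text \<open>A connected set that is not a singleton has no isolated points. Hence derivatives within
  \<open>I\<close> are unique, also at end points.\<close>

lemma at_within_parameter_nontrivial:
  assumes t: "t \<in> I"
  shows "at t within I \<noteq> bot"
proof -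
  have "connected I" "interior I \<noteq> {}"
    using curve by (auto simp: smooth_curve_def is_interval_connected)
  moreover from this have "\<nexists>s. I = {s}" by auto
  ultimately have "t islimpt I" using connected_imp_perfect t by blast
  then show ?thesis by (simp add: trivial_limit_within)
qed

text \<open>Smoothness of a field is stated on the parameters that \<open>\<gamma>\<close> maps into
  the chart. By continuity these form a relatively open part of \<open>I\<close>, so derivatives
  within either set agree.\<close>

lemma field_differentiable:
  assumes V: "field_along M I \<gamma> V" and t: "t \<in> I" and c: "c \<in> charts_at M (\<gamma> t)"
  shows "(\<lambda>s. V s c) differentiable (at t within I)"
proof -
  let ?J = "{s \<in> I. \<gamma> s \<in> fst c}"
  have "openin (top_of_set I) {s \<in> topspace (top_of_set I). \<gamma> s \<in> fst c}"
    using curve chart_openin[OF charts_atD(1)[OF c]] openin_continuous_map_preimage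
    unfolding smooth_curve_def by blast
  then obtain U where U: "open U" "?J = I \<inter> U" by (auto simp: openin_open)
  have tJ: "t \<in> ?J" using t charts_atD[OF c] by simp
  have "(\<lambda>s. V s c) differentiable (at t within ?J)"
    using V charts_atD(1)[OF c] smooth_on_differentiable_on tJ
    unfolding field_along_def differentiable_on_def by blast
  moreover have "at t within ?J = at t within I"
    by (rule at_within_nhd[where S = U]) (use U tJ in auto)
  ultimately show ?thesis by simp
qed

text \<open>The formulas for the iterated derivatives hold on \<open>I\<close> only; since
  \<open>nabla_T\<close> differentiates within \<open>I\<close>, they may still be substituted under
  it.\<close>

lemma nabla_T_cong:
  assumes eq: "\<And>s. s \<in> I \<Longrightarrow> V s = W s" and t: "t \<in> I"
  shows "nabla_T M I \<gamma> V t = nabla_T M I \<gamma> W t"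
proof -
  have "((\<lambda>s. V s c) has_vector_derivative D) (at t within I)
      \<longleftrightarrow> ((\<lambda>s. W s c) has_vector_derivative D) (at t within I)" for c D
    using has_vector_derivative_transform[OF t, of "\<lambda>s. V s c" "\<lambda>s. W s c"]
      has_vector_derivative_transform[OF t, of "\<lambda>s. W s c" "\<lambda>s. V s c"] eq by auto
  then have "vector_derivative (\<lambda>s. V s c) (at t within I) = vector_derivative (\<lambda>s. W s c) (at t within I)" for c
    by (simp add: vector_derivative_def)
  then show ?thesis by (simp add: nabla_T_def eq[OF t])
qed

lemma nabla_T_lincomb:
  assumes V: "field_along M I \<gamma> V" and W: "field_along M I \<gamma> W" and t: "t \<in> I"
  shows "nabla_T M I \<gamma> (\<lambda>s d. a *\<^sub>R V s d + b *\<^sub>R W s d) t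
    = (\<lambda>d. a *\<^sub>R nabla_T M I \<gamma> V t d + b *\<^sub>R nabla_T M I \<gamma> W t d)"
proof -
  let ?p = "\<gamma> t" and ?c = "chart_at M (\<gamma> t)"
  have p: "?p \<in> topspace (mtop M)" by (rule curve_in_manifold[OF t])
  have c: "?c \<in> charts_at M ?p" by (rule chart_at_charts_at[OF p])
  interpret local_riemannian_metric "snd ?c ` fst ?c" "local_metric M ?c"
    by (rule chart_at_metric[OF p])
  have lin: "linear (christoffel M ?c (snd ?c ?p) v)" for v
    unfolding christoffel_eq[OF charts_atD(1)[OF c]]
    by (rule \<Gamma>_linear2[OF chart_at_metric(2)[OF p]])
  have "vector_derivative (\<lambda>s. a *\<^sub>R V s ?c + b *\<^sub>R W s ?c) (at t within I)
      = a *\<^sub>R vector_derivative (\<lambda>s. V s ?c) (at t within I)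
        + b *\<^sub>R vector_derivative (\<lambda>s. W s ?c) (at t within I)"
    using field_differentiable[OF V t c] field_differentiable[OF W t c]
    by (intro vector_derivative_within[OF at_within_parameter_nontrivial[OF t]])
       (auto intro!: derivative_eq_intros simp: vector_derivative_works)
  then have "nabla_T M I \<gamma> (\<lambda>s d. a *\<^sub>R V s d + b *\<^sub>R W s d) t = coord_vec M ?p ?c
      (a *\<^sub>R (vector_derivative (\<lambda>s. V s ?c) (at t within I)
          + christoffel M ?c (snd ?c ?p) (velocity M I \<gamma> t ?c) (V t ?c))
       + b *\<^sub>R (vector_derivative (\<lambda>s. W s ?c) (at t within I)
          + christoffel M ?c (snd ?c ?p) (velocity M I \<gamma> t ?c) (W t ?c)))"
    by (simp add: nabla_T_def Let_def linear_add[OF lin] linear_cmul[OF lin] algebra_simps)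
  then show ?thesis
    unfolding coord_vec_lincomb[OF c] by (simp add: nabla_T_def Let_def)
qed

end

section \<open>Frenet helices\<close>

locale frenet_helix = riemannian M for M :: "('m, 'n::{finite,linorder}) riem" +
  fixes I :: "real set" and \<gamma> :: "real \<Rightarrow> 'm" and T N B :: "real \<Rightarrow> ('m, 'n) tvec" and \<kappa> \<tau> :: real
  assumes helix: "frenet_helix3 M I \<gamma> T N B \<kappa> \<tau>"
begin

sublocale riemannian_curve M I \<gamma>
  by standard (use helix in \<open>simp add: frenet_helix3_def\<close>)

abbreviation q :: real where "q \<equiv> \<kappa>\<^sup>2 + \<tau>\<^sup>2"

lemma curvature_pos: "\<kappa> > 0"
  using helix by (simp add: frenet_helix3_def)

lemma q_pos: "q > 0"
  using curvature_pos by (simp add: add_pos_nonneg)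

lemma velocity_eq: "t \<in> I \<Longrightarrow> velocity M I \<gamma> t = T t"
  using helix by (simp add: frenet_helix3_def)

lemma frame_field: "field_along M I \<gamma> T" "field_along M I \<gamma> N" "field_along M I \<gamma> B"
  using helix by (simp_all add: frenet_helix3_def)

lemma frame_tangent:
  assumes "t \<in> I"
  shows "T t \<in> tangent_space M (\<gamma> t)" "N t \<in> tangent_space M (\<gamma> t)" "B t \<in> tangent_space M (\<gamma> t)"
  using frame_field assms by (simp_all add: field_along_def)

lemma frame_orthonormal: "t \<in> I \<Longrightarrow> orthonormal3 M (\<gamma> t) (T t) (N t) (B t)"
  using helix unfolding frenet_helix3_def by blast

lemma frenet_equations:
  assumes "t \<in> I"
  shows "nabla_T M I \<gamma> T t = (\<lambda>c. \<kappa> *\<^sub>R N t c)"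
    "nabla_T M I \<gamma> N t = (\<lambda>c. - \<kappa> *\<^sub>R T t c + \<tau> *\<^sub>R B t c)"
    "nabla_T M I \<gamma> B t = (\<lambda>c. - \<tau> *\<^sub>R N t c)"
  using helix assms by (simp_all add: frenet_helix3_def)

section \<open>Iterated covariant derivatives of the tangent of a helix\<close>

lemma nabla_pow_Suc: "nabla_pow M I \<gamma> (Suc k) = nabla_T M I \<gamma> (nabla_pow M I \<gamma> k)"
  by (simp add: nabla_pow_def)

lemma nabla_T_normal:
  assumes t: "t \<in> I" and V: "\<And>s. s \<in> I \<Longrightarrow> V s = (\<lambda>d. a *\<^sub>R N s d)"
  shows "nabla_T M I \<gamma> V t = (\<lambda>d. (- (a * \<kappa>)) *\<^sub>R T t d + (a * \<tau>) *\<^sub>R B t d)"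
proof -
  \<comment> \<open>The summand with coefficient 0 brings a single multiple into the form of
    \<open>nabla_T_lincomb\<close>.\<close>
  have "nabla_T M I \<gamma> V t = nabla_T M I \<gamma> (\<lambda>s d. a *\<^sub>R N s d + 0 *\<^sub>R N s d) t"
    by (rule nabla_T_cong[OF _ t]) (simp add: V)
  then show ?thesis
    unfolding nabla_T_lincomb[OF frame_field(2) frame_field(2) t] frenet_equations[OF t]
    by (simp add: algebra_simps)
qed

lemma nabla_T_rectifying:
  assumes t: "t \<in> I" and V: "\<And>s. s \<in> I \<Longrightarrow> V s = (\<lambda>d. a *\<^sub>R T s d + b *\<^sub>R B s d)"
  shows "nabla_T M I \<gamma> V t = (\<lambda>d. (a * \<kappa> - b * \<tau>) *\<^sub>R N t d)"
proof -
  have "nabla_T M I \<gamma> V t = nabla_T M I \<gamma> (\<lambda>s d. a *\<^sub>R T s d + b *\<^sub>R B s d) t"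
    by (rule nabla_T_cong[OF V t])
  then show ?thesis
    unfolding nabla_T_lincomb[OF frame_field(1) frame_field(3) t] frenet_equations[OF t]
    by (simp add: algebra_simps)
qed

text \<open>Both parities are proved in one induction, each formula being the derivative of the
  other. Two derivatives contribute a factor \<open>- q\<close>. The even formula starts at order 2
  because \<open>T\<close> itself is not of this form.\<close>

lemma nabla_pow_odd:
    "t \<in> I \<Longrightarrow> nabla_pow M I \<gamma> (2 * j + 1) t = (\<lambda>d. ((- 1) ^ j * \<kappa> * q ^ j) *\<^sub>R N t d)"
  and nabla_pow_even: "t \<in> I \<Longrightarrow> nabla_pow M I \<gamma> (2 * j + 2) t
    = (\<lambda>d. ((- 1) ^ Suc j * \<kappa>\<^sup>2 * q ^ j) *\<^sub>R T t d + ((- 1) ^ j * \<kappa> * \<tau> * q ^ j) *\<^sub>R B t d)"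
proof (induction j arbitrary: t)
  case 0
  have one: "nabla_pow M I \<gamma> 1 t = (\<lambda>d. \<kappa> *\<^sub>R N t d)" if "t \<in> I" for t
  proof -
    have "nabla_pow M I \<gamma> 1 t = nabla_T M I \<gamma> (velocity M I \<gamma>) t"
      by (simp add: nabla_pow_def)
    also have "\<dots> = nabla_T M I \<gamma> T t"
      by (rule nabla_T_cong[OF velocity_eq that])
    finally show ?thesis using frenet_equations(1)[OF that] by simp
  qed
  {
    case 1
    then show ?case using one by simp
  next
    case 2
    then show ?case
      using nabla_T_normal[OF 2 one] nabla_pow_Suc[of 1]
      by (simp add: power2_eq_square numeral_2_eq_2)
  }
next
  case (Suc j)
  have odd: "nabla_pow M I \<gamma> (2 * Suc j + 1) t = (\<lambda>d. ((- 1) ^ Suc j * \<kappa> * q ^ Suc j) *\<^sub>R N t d)"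
    if "t \<in> I" for t
  proof -
    have "nabla_pow M I \<gamma> (2 * Suc j + 1) t = nabla_T M I \<gamma> (nabla_pow M I \<gamma> (2 * j + 2)) t"
      using nabla_pow_Suc[of "2 * j + 2"] by simp
    also have "\<dots> = (\<lambda>d. (((- 1) ^ Suc j * \<kappa>\<^sup>2 * q ^ j) * \<kappa> - ((- 1) ^ j * \<kappa> * \<tau> * q ^ j) * \<tau>) *\<^sub>R N t d)"
      by (rule nabla_T_rectifying[OF that Suc.IH(2)])
    also have "((- 1) ^ Suc j * \<kappa>\<^sup>2 * q ^ j) * \<kappa> - ((- 1) ^ j * \<kappa> * \<tau> * q ^ j) * \<tau>
        = (- 1) ^ Suc j * \<kappa> * q ^ Suc j"
      by (simp add: algebra_simps power2_eq_square)
    finally show ?thesis .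
  qed
  {
    case 1
    then show ?case by (rule odd)
  next
    case 2
    then show ?case
      using nabla_T_normal[OF 2 odd] nabla_pow_Suc[of "2 * Suc j + 1"]
      by (simp add: power2_eq_square algebra_simps)
  }
qed

text \<open>The orders \<open>l\<close> and \<open>2 * m + 1 - l\<close> have opposite parity, so
  one argument is a multiple of \<open>N\<close> and the other of
  \<open>- \<kappa> T + \<tau> B\<close>. Interchanging the two costs a sign, which
  \<open>(- 1) ^ l\<close> compensates.\<close>

lemma curvature_term:
  assumes t: "t \<in> I" and l: "1 \<le> l" "l \<le> m"
  shows "(- 1) ^ l *\<^sub>R curvature M (\<gamma> t) (nabla_pow M I \<gamma> (2 * m + 1 - l) t) (nabla_pow M I \<gamma> l t) (T t) d
    = ((- 1) ^ m * \<kappa>\<^sup>2 * q ^ (m - 1)) *\<^sub>R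
        (\<kappa> *\<^sub>R curvature M (\<gamma> t) (N t) (T t) (T t) d - \<tau> *\<^sub>R curvature M (\<gamma> t) (N t) (B t) (T t) d)"
proof -
  let ?p = "\<gamma> t"
  have p: "?p \<in> topspace (mtop M)" by (rule curve_in_manifold[OF t])
  have NT: "curvature M ?p (\<lambda>d. a *\<^sub>R N t d) (\<lambda>d. b *\<^sub>R T t d + e *\<^sub>R B t d) Z d
    = (a * b) *\<^sub>R curvature M ?p (N t) (T t) Z d + (a * e) *\<^sub>R curvature M ?p (N t) (B t) Z d" for a b e Z
    using curvature_lincomb_left[OF p, of a "N t" 0 "N t"]
    by (simp add: curvature_lincomb_right[OF p] algebra_simps)
  have TN: "curvature M ?p (\<lambda>d. b *\<^sub>R T t d + e *\<^sub>R B t d) (\<lambda>d. a *\<^sub>R N t d) Z d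
    = - ((a * b) *\<^sub>R curvature M ?p (N t) (T t) Z d + (a * e) *\<^sub>R curvature M ?p (N t) (B t) Z d)" for a b e Z
    by (subst curvature_swap[OF p]) (simp add: NT)
  show ?thesis
  proof (cases "even l")
    case True
    then obtain k where "l = 2 * k" by (rule evenE)
    then have "l = 2 * (k - 1) + 2" using l(1) by simp
    then obtain j where j: "l = 2 * j + 2" by blast
    \<comment> \<open>\<open>i\<close> indexes the complementary derivative as \<open>j\<close>
      indexes the one of order \<open>l\<close>. In both parities \<open>j + i = m - 1\<close>, the
      exponent of \<open>q\<close> in the product.\<close>
    obtain i where i: "m = j + i + 1" using that[of "m - j - 1"] l j by simp
    have e: "2 * m + 1 - l = 2 * i + 1" using i j by simp
    show ?thesis
      unfolding e unfolding j nabla_pow_odd[OF t] nabla_pow_even[OF t] NT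
      by (simp add: i power_add power2_eq_square algebra_simps)
  next
    case False
    then obtain j where j: "l = 2 * j + 1" by (rule oddE)
    obtain i where i: "m = j + i + 1" using that[of "m - j - 1"] l j by simp
    have e: "2 * m + 1 - l = 2 * i + 2" using i j by simp
    show ?thesis
      unfolding e unfolding j nabla_pow_odd[OF t] nabla_pow_even[OF t] TN
      by (simp add: i power_add power2_eq_square algebra_simps)
  qed
qed

text \<open>The vector \<open>V\<close> of the overview, with its coefficients written out.\<close>

definition rescaled_tension :: "nat \<Rightarrow> real \<Rightarrow> ('m, 'n) tvec" where
  "rescaled_tension r t = (\<lambda>d. (- (q\<^sup>2)) *\<^sub>R N t d
     + (\<kappa>\<^sup>2 * (real r - 1) + \<tau>\<^sup>2) *\<^sub>R curvature M (\<gamma> t) (N t) (T t) (T t) d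
     + (- (\<kappa> * \<tau> * (real r - 2))) *\<^sub>R curvature M (\<gamma> t) (N t) (B t) (T t) d)"

text \<open>With \<open>m = r - 2\<close>, the term for \<open>l = 0\<close> contributes
  \<open>q\<close> to the coefficient of R(N, T)T and the \<open>m\<close> equal terms contribute
  \<open>m * \<kappa>\<^sup>2\<close>; together this is
  \<open>\<kappa>\<^sup>2 * (r - 1) + \<tau>\<^sup>2\<close>.\<close>

lemma tension_eq:
  assumes t: "t \<in> I" and r: "r \<ge> 2"
  shows "q *\<^sub>R tension M I \<gamma> r t d = ((- 1) ^ r * \<kappa> * q ^ (r - 2)) *\<^sub>R rescaled_tension r t d"
proof -
  obtain m where m: "r = m + 2" using that[of "r - 2"] r by simp
  have p: "\<gamma> t \<in> topspace (mtop M)" by (rule curve_in_manifold[OF t])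
  let ?R1 = "curvature M (\<gamma> t) (N t) (T t) (T t) d" and ?R2 = "curvature M (\<gamma> t) (N t) (B t) (T t) d"
  let ?f = "\<lambda>l. (- 1) ^ l *\<^sub>R curvature M (\<gamma> t) (nabla_pow M I \<gamma> (2 * m + 1 - l) t) (nabla_pow M I \<gamma> l t) (T t) d"
  have top: "nabla_pow M I \<gamma> (2 * r - 1) t d = ((- 1) ^ Suc m * \<kappa> * q ^ Suc m) *\<^sub>R N t d"
    using nabla_pow_odd[OF t, of "Suc m"] m by simp
  have zero: "?f 0 = ((- 1) ^ m * \<kappa> * q ^ m) *\<^sub>R ?R1"
    using nabla_pow_odd[OF t, of m] velocity_eq[OF t]
      curvature_lincomb_left[OF p, of "(- 1) ^ m * \<kappa> * q ^ m" "N t" 0 "N t"]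
    by (simp add: nabla_pow_def[of M I \<gamma> 0])
  have "(\<Sum>l = 1..m. ?f l) = (\<Sum>l = 1..m. ((- 1) ^ m * \<kappa>\<^sup>2 * q ^ (m - 1)) *\<^sub>R (\<kappa> *\<^sub>R ?R1 - \<tau> *\<^sub>R ?R2))"
    by (intro sum.cong refl curvature_term t) auto
  also have "\<dots> = (real m * ((- 1) ^ m * \<kappa>\<^sup>2 * q ^ (m - 1))) *\<^sub>R (\<kappa> *\<^sub>R ?R1 - \<tau> *\<^sub>R ?R2)"
    by (simp only: sum_constant_scaleR card_atLeastAtMost scaleR_scaleR) simp
  \<comment> \<open>The factor \<open>q\<close> removes the truncated exponent \<open>m - 1\<close>;
    for \<open>m = 0\<close> the sum is empty and both sides vanish.\<close>
  finally have rest: "q *\<^sub>R (\<Sum>l = 1..m. ?f l)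
      = (real m * ((- 1) ^ m * \<kappa>\<^sup>2 * q ^ m)) *\<^sub>R (\<kappa> *\<^sub>R ?R1 - \<tau> *\<^sub>R ?R2)"
    by (cases m) (simp_all add: mult_ac)
  have "tension M I \<gamma> r t d = nabla_pow M I \<gamma> (2 * r - 1) t d + (\<Sum>l = 0..m. ?f l)"
    by (simp add: tension_def m velocity_eq[OF t])
  also have "(\<Sum>l = 0..m. ?f l) = ?f 0 + (\<Sum>l = 1..m. ?f l)"
    by (simp add: sum.atLeast_Suc_atMost)
  finally have "q *\<^sub>R tension M I \<gamma> r t d = q *\<^sub>R ((- 1) ^ Suc m * \<kappa> * q ^ Suc m) *\<^sub>R N t d
      + q *\<^sub>R ((- 1) ^ m * \<kappa> * q ^ m) *\<^sub>R ?R1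
      + (real m * ((- 1) ^ m * \<kappa>\<^sup>2 * q ^ m)) *\<^sub>R (\<kappa> *\<^sub>R ?R1 - \<tau> *\<^sub>R ?R2)"
    by (simp only: top zero scaleR_add_right rest add.assoc)
  also have "\<dots> = ((- 1) ^ m * \<kappa> * q ^ m) *\<^sub>R
      ((- (q\<^sup>2)) *\<^sub>R N t d + q *\<^sub>R ?R1 + (real m * \<kappa>) *\<^sub>R (\<kappa> *\<^sub>R ?R1 - \<tau> *\<^sub>R ?R2))"
    by (simp add: scaleR_add_right scaleR_diff_right power2_eq_square mult_ac)
  also have "(- (q\<^sup>2)) *\<^sub>R N t d + q *\<^sub>R ?R1 + (real m * \<kappa>) *\<^sub>R (\<kappa> *\<^sub>R ?R1 - \<tau> *\<^sub>R ?R2) = rescaled_tension r t d"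
    unfolding rescaled_tension_def m
    by (simp add: scaleR_add_left scaleR_diff_left scaleR_diff_right power2_eq_square algebra_simps)
  finally show ?thesis by (simp add: m)
qed

section \<open>Vanishing of the tension field\<close>

lemma tension_zero_iff:
  assumes t: "t \<in> I" and r: "r \<ge> 2"
  shows "tension M I \<gamma> r t = (\<lambda>_. 0) \<longleftrightarrow> rescaled_tension r t = (\<lambda>_. 0)"
proof -
  have "tension M I \<gamma> r t d = 0 \<longleftrightarrow> rescaled_tension r t d = 0" for d
    using tension_eq[OF t r, of d] q_pos curvature_pos
    by (metis mult_eq_0_iff order_less_irrefl power_not_zero scaleR_eq_0_iff zero_neq_neg_one)
  then show ?thesis by (simp add: fun_eq_iff)
qed

text \<open>As \<open>\<kappa> > 0\<close>, a geodesic would have \<open>N = 0\<close>, against its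
  unit length.\<close>

lemma not_geodesic: "\<not> geodesic M I \<gamma>"
proof
  assume "geodesic M I \<gamma>"
  moreover have "I \<noteq> {}" using curve by (auto simp: smooth_curve_def)
  ultimately obtain t where t: "t \<in> I" and zero: "nabla_T M I \<gamma> (velocity M I \<gamma>) t = (\<lambda>_. 0)"
    unfolding geodesic_def by blast
  have "(\<lambda>d. \<kappa> *\<^sub>R N t d) = (\<lambda>_. 0)"
    using nabla_T_cong[OF velocity_eq t] zero frenet_equations(1)[OF t] by simp
  then have "N t = (\<lambda>_. 0)" using curvature_pos by (simp add: fun_eq_iff)
  then show False
    using frame_orthonormal[OF t] metric_zero_left[OF curve_in_manifold[OF t] frame_tangent(2)[OF t]]
    by (simp add: orthonormal3_def)
qed

lemma metric_rescaled_tension: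
  assumes t: "t \<in> I" and W: "W \<in> tangent_space M (\<gamma> t)"
  shows "metric M (\<gamma> t) (rescaled_tension r t) W = - (q\<^sup>2) * metric M (\<gamma> t) (N t) W
     + (\<kappa>\<^sup>2 * (real r - 1) + \<tau>\<^sup>2) * metric M (\<gamma> t) (curvature M (\<gamma> t) (N t) (T t) (T t)) W
     + (- (\<kappa> * \<tau> * (real r - 2))) * metric M (\<gamma> t) (curvature M (\<gamma> t) (N t) (B t) (T t)) W"
proof -
  note p = curve_in_manifold[OF t]
  note R = curvature_tangent[OF p]
  show ?thesis
    using metric_lincomb[OF p tangent_lincomb[OF frame_tangent(2)[OF t] R] R W, of 1]
      metric_lincomb[OF p frame_tangent(2)[OF t] R W]
    unfolding rescaled_tension_def by (simp only: scaleR_one mult_1)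
qed

lemma rescaled_tension_tangent:
  assumes t: "t \<in> I"
  shows "rescaled_tension r t \<in> tangent_space M (\<gamma> t)"
proof -
  note R = curvature_tangent[OF curve_in_manifold[OF t]]
  show ?thesis
    using tangent_lincomb[OF tangent_lincomb[OF frame_tangent(2)[OF t] R] R, of 1]
    unfolding rescaled_tension_def by (simp only: scaleR_one)
qed

text \<open>
  The tension has no \<open>T\<close>-component, so it is orthogonal to the Frenet frame as soon as it is
  orthogonal to \<open>N\<close> and \<open>B\<close>; by the curvature hypotheses it is then orthogonal to itself.
\<close>

lemma rescaled_tension_zero_iff:
  assumes t: "t \<in> I"
    and R1: "\<And>W. W \<in> span3_perp M (\<gamma> t) (T t) (N t) (B t) \<Longrightarrow>
      metric M (\<gamma> t) (curvature M (\<gamma> t) (N t) (T t) (T t)) W = 0"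
    and R2: "\<And>W. W \<in> span3_perp M (\<gamma> t) (T t) (N t) (B t) \<Longrightarrow>
      metric M (\<gamma> t) (curvature M (\<gamma> t) (N t) (B t) (T t)) W = 0"
  shows "rescaled_tension r t = (\<lambda>_. 0) \<longleftrightarrow>
    metric M (\<gamma> t) (rescaled_tension r t) (N t) = 0 \<and> metric M (\<gamma> t) (rescaled_tension r t) (B t) = 0"
proof
  assume "rescaled_tension r t = (\<lambda>_. 0)"
  then show "metric M (\<gamma> t) (rescaled_tension r t) (N t) = 0 \<and> metric M (\<gamma> t) (rescaled_tension r t) (B t) = 0"
    by (simp add: metric_zero_left curve_in_manifold frame_tangent t)
next
  let ?p = "\<gamma> t" and ?V = "rescaled_tension r t"
  assume NB: "metric M ?p ?V (N t) = 0 \<and> metric M ?p ?V (B t) = 0"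
  note p = curve_in_manifold[OF t]
  note frame = frame_tangent[OF t]
  note V = rescaled_tension_tangent[OF t, of r]
  have "metric M ?p (N t) (T t) = 0"
    using frame_orthonormal[OF t] metric_comm[OF p frame(1) frame(2)] by (simp add: orthonormal3_def)
  \<comment> \<open>Both curvature terms end in \<open>T\<close>, so \<open>curvature_skew\<close>
    removes them; the remaining term vanishes as \<open>N\<close> is orthogonal to
    \<open>T\<close>.\<close>
  then have VT: "metric M ?p ?V (T t) = 0"
    using metric_rescaled_tension[OF t frame(1)] curvature_skew[OF p frame(1)] by simp
  have perp: "metric M ?p (T t) ?V = 0" "metric M ?p (N t) ?V = 0" "metric M ?p (B t) ?V = 0"
    using VT NB metric_comm[OF p V] frame by simp_all
  have "metric M ?p (\<lambda>c. x *\<^sub>R T t c + y *\<^sub>R N t c + z *\<^sub>R B t c) ?V = 0" for x y z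
    using metric_lincomb[OF p tangent_lincomb[OF frame(1) frame(2)] frame(3) V, of 1 x y z]
      metric_lincomb[OF p frame(1) frame(2) V, of x y] perp by simp
  then have "?V \<in> span3_perp M ?p (T t) (N t) (B t)"
    using V by (simp add: span3_perp_def)
  then have "metric M ?p ?V ?V = 0"
    using metric_rescaled_tension[OF t V] perp R1 R2 by simp
  then show "?V = (\<lambda>_. 0)"
    using metric_positive[OF p V] by force
qed

end

theorem corollary1p7:
  fixes M :: "('m, 'n::{finite,linorder}) riem"
    and I :: "real set" and \<gamma> :: "real \<Rightarrow> 'm"
    and T N B :: "real \<Rightarrow> ('m, 'n) tvec"
    and \<kappa> \<tau> A1 A2 A3 :: real and r :: nat
  assumes "oriented_riemannian_manifold M"
    and "CARD('n) \<ge> 3"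
    and "frenet_helix3 M I \<gamma> T N B \<kappa> \<tau>"
    and "r \<ge> 2"
    and "\<And>t W. t \<in> I \<Longrightarrow> W \<in> span3_perp M (\<gamma> t) (T t) (N t) (B t) \<Longrightarrow>
           metric M (\<gamma> t) (curvature M (\<gamma> t) (N t) (T t) (T t)) W = 0"
    and "\<And>t W. t \<in> I \<Longrightarrow> W \<in> span3_perp M (\<gamma> t) (T t) (N t) (B t) \<Longrightarrow>
           metric M (\<gamma> t) (curvature M (\<gamma> t) (N t) (B t) (T t)) W = 0"
    and "A1 = \<kappa>\<^sup>2 * (real r - 1) + \<tau>\<^sup>2"
    and "A2 = - \<kappa> * \<tau> * (real r - 2)"
    and "A3 = - (\<kappa>\<^sup>2 + \<tau>\<^sup>2)\<^sup>2"
  shows "proper_r_harmonic M I \<gamma> r \<longleftrightarrow>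
    (\<forall>t\<in>I.
       A1 * curvature4 M (\<gamma> t) (N t) (T t) (N t) (T t)
         + A2 * curvature4 M (\<gamma> t) (N t) (B t) (N t) (T t) + A3 = 0 \<and>
       A1 * curvature4 M (\<gamma> t) (N t) (T t) (B t) (T t)
         + A2 * curvature4 M (\<gamma> t) (N t) (B t) (B t) (T t) = 0)"
proof -
  interpret frenet_helix M I \<gamma> T N B \<kappa> \<tau>
    by standard (use assms in \<open>simp_all add: oriented_riemannian_manifold_def\<close>)
  have "tension M I \<gamma> r t = (\<lambda>_. 0) \<longleftrightarrow>
      A1 * curvature4 M (\<gamma> t) (N t) (T t) (N t) (T t)
        + A2 * curvature4 M (\<gamma> t) (N t) (B t) (N t) (T t) + A3 = 0 \<and>
      A1 * curvature4 M (\<gamma> t) (N t) (T t) (B t) (T t)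
        + A2 * curvature4 M (\<gamma> t) (N t) (B t) (B t) (T t) = 0" if t: "t \<in> I" for t
  proof -
    \<comment> \<open>The product with \<open>N\<close> yields equation (i), where \<open>A3\<close>
      is multiplied by 1; the product with \<open>B\<close> yields (ii), where it is multiplied by
      0.\<close>
    have NN: "metric M (\<gamma> t) (N t) (N t) = 1" and NB: "metric M (\<gamma> t) (N t) (B t) = 0"
      using frame_orthonormal[OF t] by (simp_all add: orthonormal3_def)
    have "rescaled_tension r t = (\<lambda>_. 0) \<longleftrightarrow>
        metric M (\<gamma> t) (rescaled_tension r t) (N t) = 0 \<and> metric M (\<gamma> t) (rescaled_tension r t) (B t) = 0"
      by (rule rescaled_tension_zero_iff[OF t]) (simp_all add: assms(5,6) t)
    then show ?thesis
      unfolding tension_zero_iff[OF t \<open>r \<ge> 2\<close>] metric_rescaled_tension[OF t frame_tangent(2)[OF t]] metric_rescaled_tension[OF t frame_tangent(3)[OF t]]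
        curvature4_def NN NB assms(7-9)
      by (simp add: algebra_simps)
  qed
  moreover have "smooth_curve M I \<gamma>" "unit_speed M I \<gamma>"
    using assms(3) by (simp_all add: frenet_helix3_def)
  ultimately show ?thesis
    using not_geodesic by (simp add: proper_r_harmonic_def r_harmonic_def)
qed

end
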